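(* Let $\Sigma$ be a one-sided shift space over a countable alphabet, with left shift $\sigma$, that satisfies both (1) (finite cyclic predecessor assumption) $\mathscr{P}(a)\cap\mathscr{F}_m(a)$ is finite for every $a\in\mathscr{L}_1$ and for all $m\ge 1$; (2) (denseness of periodic measures) the set of ergodic probabilities supported on periodic orbits of $\Sigma$ is weak$^\ast$ dense in the set of $\sigma$-invariant Borel probability measures on $\Sigma$. Then every upper semi-continuous potential $A:\Sigma\to\mathbb{R}$ fulfilling $$\limsup_{i\to\infty}\ \sup A|_{[i]}<\beta(A)$$ has a maximizing probability, i.e. there is a $\sigma$-invariant Borel probability measure $\mu$ on $\Sigma$ with $\int_\Sigma A\,d\mu=\beta(A)$. Furthermore, if $\sup A\le\beta(A)$, then there exists a common finite alphabet subshift of $\Sigma$ that contains the support of every maximizing probability for $A$.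
   Context: The countable alphabet $\mathscr{A}$ is identified with the non-negative integers and has the discrete topology; $\Sigma\subset\mathscr{A}^{\mathbb{N}}$ is a one-sided shift space (closed, $\sigma(\Sigma)\subset\Sigma$, product topology), with points written $x=(x_0,x_1,\ldots)$ and $\sigma(x_0,x_1,\ldots)=(x_1,x_2,\ldots)$. Language: $\mathscr{L}_0=\{\epsilon\}$ (empty word), $\mathscr{L}_k=\{(x_0,\ldots,x_{k-1}):x\in\Sigma\}$ for $k\ge1$, and $\mathscr{L}=\bigcup_{k\ge0}\mathscr{L}_k$. For $w\in\mathscr{L}$: $\mathscr{P}(w)=\{a\in\mathscr{L}_1: aw\in\mathscr{L}\}$, $\mathscr{F}_1(w)=\{b\in\mathscr{L}_1: wb\in\mathscr{L}\}$, and for $m\ge2$, $\mathscr{F}_m(w)=\{b\in\mathscr{L}_1: wvb\in\mathscr{L}\text{ for some }v\in\mathscr{L}_{m-1}\}$. Cylinders: $[w]=\{x\in\Sigma: x_i=w_i,\ 0\le i<\ell(w)\}$, where $\ell(w)$ is the length of $w$; in particular $[i]=\{x\in\Sigma:x_0=i\}$. Suprema over empty sets are $-\infty$. A potential is a Borel function $A:\Sigma\to\mathbb{R}$ bounded from above. Its ergodic maximizing constant is $\beta(A)=\sup\{\int_\Sigma A\,d\mu:\mu\text{ is a }\sigma\text{-invariant Borel probability measure on }\Sigma\}$. A maximizing probability for $A$ is a $\sigma$-invariant Borel probability measure $\mu$ with $\int A\,d\mu=\beta(A)$. A finite alphabet subshift of $\Sigma$ is a shift space contained in $\Sigma$ that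 uses only finitely many symbols. *)

theory Defs
  imports "HOL-Probability.Probability"
begin

text \<open>
  The alphabet is the type \<^typ>\<open>nat\<close> with its discrete topology, and
  \<^typ>\<open>nat \<Rightarrow> nat\<close> carries the library's product topology and its Borel sets.
\<close>

definition shift :: "(nat \<Rightarrow> nat) \<Rightarrow> (nat \<Rightarrow> nat)" where
  "shift x = (\<lambda>n. x (Suc n))"

definition shift_space :: "(nat \<Rightarrow> nat) set \<Rightarrow> bool" where
  "shift_space X \<longleftrightarrow> closed X \<and> shift ` X \<subseteq> X"

definition finite_alphabet_subshift :: "(nat \<Rightarrow> nat) set \<Rightarrow> (nat \<Rightarrow> nat) set \<Rightarrow> bool" where
  "finite_alphabet_subshift X Y \<longleftrightarrow>
     shift_space Y \<and> Y \<subseteq> X \<and> (\<exists>F. finite F \<and> (\<forall>y\<in>Y. \<forall>n. y n \<in> F))"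


subsection \<open>Language\<close>

definition words :: "(nat \<Rightarrow> nat) set \<Rightarrow> nat \<Rightarrow> nat list set" where
  "words X k = (if k = 0 then {[]} else {map x [0..<k] |x. x \<in> X})"

definition lang :: "(nat \<Rightarrow> nat) set \<Rightarrow> nat list set" where
  "lang X = (\<Union>k. words X k)"

definition predecessors :: "(nat \<Rightarrow> nat) set \<Rightarrow> nat list \<Rightarrow> nat set" where
  "predecessors X w = {a. [a] \<in> words X 1 \<and> a # w \<in> lang X}"

text \<open>Meant for \<open>m \<ge> 1\<close>; as \<open>words X 0 = {[]}\<close>, the case \<open>m = 1\<close> says \<open>w @ [b] \<in> lang X\<close>.\<close>

definition followers :: "(nat \<Rightarrow> nat) set \<Rightarrow> nat \<Rightarrow> nat list \<Rightarrow> nat set" where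
  "followers X m w =
     {b. [b] \<in> words X 1 \<and> (\<exists>v\<in>words X (m - 1). w @ v @ [b] \<in> lang X)}"

definition cylinder :: "(nat \<Rightarrow> nat) set \<Rightarrow> nat list \<Rightarrow> (nat \<Rightarrow> nat) set" where
  "cylinder X w = {x \<in> X. \<forall>i<length w. x i = w ! i}"

definition finite_cyclic_predecessor :: "(nat \<Rightarrow> nat) set \<Rightarrow> bool" where
  "finite_cyclic_predecessor X \<longleftrightarrow>
     (\<forall>a. [a] \<in> words X 1 \<longrightarrow> (\<forall>m\<ge>1. finite (predecessors X [a] \<inter> followers X m [a])))"


subsection \<open>Probabilities on the shift space\<close>

definition borel_probs :: "(nat \<Rightarrow> nat) set \<Rightarrow> (nat \<Rightarrow> nat) measure set" where
  "borel_probs X = {\<mu>. prob_space \<mu> \<and> sets \<mu> = sets (restrict_space borel X)}"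

definition invariant_probs :: "(nat \<Rightarrow> nat) set \<Rightarrow> (nat \<Rightarrow> nat) measure set" where
  "invariant_probs X = {\<mu> \<in> borel_probs X. distr \<mu> (restrict_space borel X) shift = \<mu>}"

definition ergodic_probs :: "(nat \<Rightarrow> nat) set \<Rightarrow> (nat \<Rightarrow> nat) measure set" where
  "ergodic_probs X = {\<mu> \<in> invariant_probs X.
     \<forall>B\<in>sets \<mu>. shift -` B \<inter> space \<mu> = B \<longrightarrow> measure \<mu> B = 0 \<or> measure \<mu> B = 1}"

text \<open>The topological support, taken in the subspace topology of \<open>X\<close>.\<close>

definition supp :: "(nat \<Rightarrow> nat) set \<Rightarrow> (nat \<Rightarrow> nat) measure \<Rightarrow> (nat \<Rightarrow> nat) set" where
  "supp X \<mu> = {x \<in> X. \<forall>U. open U \<longrightarrow> x \<in> U \<longrightarrow> emeasure \<mu> (U \<inter> X) > 0}"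

definition periodic_orbits :: "(nat \<Rightarrow> nat) set \<Rightarrow> (nat \<Rightarrow> nat) set set" where
  "periodic_orbits X =
     {{(shift ^^ k) x |k. True} |x. x \<in> X \<and> (\<exists>p\<ge>1. (shift ^^ p) x = x)}"

definition periodic_probs :: "(nat \<Rightarrow> nat) set \<Rightarrow> (nat \<Rightarrow> nat) measure set" where
  "periodic_probs X = {\<mu> \<in> ergodic_probs X. \<exists>P\<in>periodic_orbits X. supp X \<mu> \<subseteq> P}"

text \<open>
  The weak* topology on Borel probabilities is the coarsest one making
  \<open>\<mu> \<mapsto> \<integral> f d\<mu>\<close> continuous for every bounded continuous \<open>f : X \<rightarrow> \<real>\<close>.
\<close>

definition weak_star :: "(nat \<Rightarrow> nat) set \<Rightarrow> (nat \<Rightarrow> nat) measure topology" where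
  "weak_star X = topology_generated_by
     {{\<mu> \<in> borel_probs X. integral\<^sup>L \<mu> f \<in> U} |(f :: (nat \<Rightarrow> nat) \<Rightarrow> real) U.
        continuous_on X f \<and> bounded (f ` X) \<and> open U}"

definition dense_periodic_probs :: "(nat \<Rightarrow> nat) set \<Rightarrow> bool" where
  "dense_periodic_probs X \<longleftrightarrow>
     subtopology (weak_star X) (invariant_probs X) closure_of periodic_probs X = invariant_probs X"


subsection \<open>Ergodic optimization\<close>

definition potential :: "(nat \<Rightarrow> nat) set \<Rightarrow> ((nat \<Rightarrow> nat) \<Rightarrow> real) \<Rightarrow> bool" where
  "potential X A \<longleftrightarrow> A \<in> borel_measurable (restrict_space borel X) \<and> bdd_above (A ` X)"

definition upper_semicontinuous_on :: "(nat \<Rightarrow> nat) set \<Rightarrow> ((nat \<Rightarrow> nat) \<Rightarrow> real) \<Rightarrow> bool" where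
  "upper_semicontinuous_on X A \<longleftrightarrow> (\<forall>c. openin (top_of_set X) {x \<in> X. A x < c})"

text \<open>
  A potential need not be integrable: its integral is positive part minus negative part and
  may be \<open>-\<infinity>\<close>, whereas the Bochner integral would be \<open>0\<close> there. For a potential and a
  probability the first term is finite, so the difference is well defined.
\<close>

definition ext_integral :: "(nat \<Rightarrow> nat) measure \<Rightarrow> ((nat \<Rightarrow> nat) \<Rightarrow> real) \<Rightarrow> ereal" where
  "ext_integral \<mu> A =
     enn2ereal (\<integral>\<^sup>+ x. ennreal (A x) \<partial>\<mu>) - enn2ereal (\<integral>\<^sup>+ x. ennreal (- A x) \<partial>\<mu>)"

definition max_const :: "(nat \<Rightarrow> nat) set \<Rightarrow> ((nat \<Rightarrow> nat) \<Rightarrow> real) \<Rightarrow> ereal" where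
  "max_const X A = (SUP \<mu>\<in>invariant_probs X. ext_integral \<mu> A)"

definition maximizing_probs ::
    "(nat \<Rightarrow> nat) set \<Rightarrow> ((nat \<Rightarrow> nat) \<Rightarrow> real) \<Rightarrow> (nat \<Rightarrow> nat) measure set" where
  "maximizing_probs X A = {\<mu> \<in> invariant_probs X. ext_integral \<mu> A = max_const X A}"

end

theory Submission
  imports Defs
begin

text \<open>
  Take invariant probabilities \<open>\<mu> n\<close> whose integrals tend to \<open>\<beta> = max_const X A\<close>. The space is not
  compact, so mass may escape to infinity. The point is that it can only escape as a whole: along a
  subsequence, \<open>\<mu> n [w] \<longlonglongrightarrow> t * \<nu> [w]\<close> for all nonempty words \<open>w\<close>, where \<open>\<nu>\<close> is again an invariant
  \<^emph>\<open>probability\<close> on \<open>X\<close> and \<open>0 \<le> t \<le> 1\<close> (\<open>invariant_probs_cylinder_compact\<close>). The lost mass \<open>1 - t\<close>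
  sits on symbols tending to infinity, where \<open>A\<close> stays below some \<open>c < \<beta>\<close>. Upper semicontinuity then
  gives \<open>\<beta> \<le> t * \<integral>A d\<nu> + (1 - t) * c \<le> t * \<beta> + (1 - t) * c\<close>, which forces \<open>t = 1\<close> and makes \<open>\<nu>\<close>
  maximizing.

  Compactness rests on a uniform tightness relative to a fixed symbol. Suppose that the words
  \<open>b a\<close> with \<open>b \<ge> B\<close> are seen twice along a point, with gap at most \<open>M\<close>. Between the two occurrences
  one reads \<open>a v b a\<close> with \<open>v\<close> short, so that \<open>b\<close> precedes \<open>a\<close> and also follows \<open>a\<close> after at most \<open>M\<close>
  steps. The finite cyclic predecessor assumption leaves only finitely many such \<open>b\<close>, hence for large
  \<open>B\<close> the event \<open>x 0 \<ge> B, x 1 = a\<close> never recurs within \<open>M\<close> steps, and an event of this kind has measure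
  at most \<open>1 / (M + 1)\<close> for \<^emph>\<open>every\<close> invariant probability. Iterating backwards gives tightness of
  \<open>x 0\<close> on \<open>x k = a\<close>, and since all but \<open>1 / (M + 1)\<close> of the points of \<open>[a]\<close> return to \<open>[a]\<close> within \<open>M\<close>
  steps, also tightness of \<open>x 1\<close> on \<open>x 0 = a\<close>. So limits of cylinder measures satisfy the left and right
  consistency equations on nonempty words. Normalised, they define \<open>\<nu>\<close> by Kolmogorov extension, and
  left consistency is the invariance of \<open>\<nu>\<close>.

  If moreover \<open>A \<le> \<beta>\<close>, then a maximizing probability lives on \<open>A = \<beta>\<close>, hence gives no mass to the
  cylinders on which \<open>A < c\<close>; by invariance, almost every point uses only the finitely
  many remaining symbols.
\<close>


section \<open>Invariance and events that cannot recur quickly\<close>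

abbreviation tail :: "nat \<Rightarrow> (nat \<Rightarrow> nat) \<Rightarrow> nat \<Rightarrow> nat" where
  "tail j x \<equiv> (\<lambda>n. x (n + j))"

lemma tail_in_shift_space:
  assumes "shift_space X" "x \<in> X"
  shows "tail j x \<in> X"
proof (induction j)
  case 0
  then show ?case using assms by simp
next
  case (Suc j)
  have "shift (tail j x) \<in> X" using Suc assms(1) by (auto simp: shift_space_def)
  then show ?case by (simp add: shift_def)
qed

lemma block_in_words:
  assumes "shift_space X" "x \<in> X"
  shows "map x [j..<j + l] \<in> words X l"
proof (cases "l = 0")
  case False
  have "map x [j..<j + l] = map (tail j x) [0..<l]"
    by (rule nth_equalityI) (auto simp: add.commute)
  then show ?thesis
    using False tail_in_shift_space[OF assms, of j] by (auto simp: words_def)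
qed (simp add: words_def)

lemma block_in_lang:
  assumes "shift_space X" "x \<in> X"
  shows "map x [j..<j + l] \<in> lang X"
  using block_in_words[OF assms] by (auto simp: lang_def)

lemma measurable_coordinate [measurable]:
  "(\<lambda>x :: nat \<Rightarrow> nat. x k) \<in> measurable borel (count_space UNIV)"
proof -
  have "(\<lambda>x :: nat \<Rightarrow> nat. x k) \<in> borel_measurable borel"
    by (intro borel_measurable_continuous_onI continuous_on_product_coordinates)
  then show ?thesis
    by (simp add: measurable_cong_sets[OF refl sets_borel_eq_count_space])
qed

lemma shift_measurable [measurable]: "shift \<in> measurable borel borel"
  unfolding shift_def
  by (intro borel_measurable_continuous_onI continuous_on_coordinatewise_then_product
      continuous_on_product_coordinates)

lemma invariant_probsD:
  assumes "\<mu> \<in> invariant_probs X"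
  shows "prob_space \<mu>" "sets \<mu> = sets (restrict_space borel X)" "space \<mu> = X"
    "distr \<mu> (restrict_space borel X) shift = \<mu>"
proof -
  show 1: "prob_space \<mu>" "sets \<mu> = sets (restrict_space borel X)"
    "distr \<mu> (restrict_space borel X) shift = \<mu>"
    using assms by (auto simp: invariant_probs_def borel_probs_def)
  show "space \<mu> = X"
    using sets_eq_imp_space_eq[OF 1(2)] by (simp add: space_restrict_space)
qed

lemma events_in_sets:
  assumes "\<mu> \<in> invariant_probs X" "Measurable.pred borel P"
  shows "{x \<in> X. P x} \<in> sets \<mu>"
proof -
  have "{x \<in> X. P x} = X \<inter> {x \<in> space borel. P x}" by auto
  also have "\<dots> \<in> sets \<mu>"
    using assms(2) unfolding invariant_probsD(2)[OF assms(1)] sets_restrict_space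
    by (intro imageI) (simp add: pred_def)
  finally show ?thesis .
qed

lemma measure_tail:
  assumes X: "shift_space X" and \<mu>: "\<mu> \<in> invariant_probs X"
    and P: "{x \<in> X. P x} \<in> sets \<mu>"
  shows "{x \<in> X. P (tail j x)} \<in> sets \<mu> \<and>
    measure \<mu> {x \<in> X. P (tail j x)} = measure \<mu> {x \<in> X. P x}"
proof (induction j)
  case 0
  show ?case using P by simp
next
  case (Suc j)
  note \<mu>' = invariant_probsD[OF \<mu>]
  let ?E = "{x \<in> X. P (tail j x)}"
  have E: "?E \<in> sets (restrict_space borel X)" using Suc \<mu>'(2) by simp
  have X_shift: "x \<in> X \<Longrightarrow> shift x \<in> X" for x using X by (auto simp: shift_space_def)
  have sm: "shift \<in> measurable \<mu> (restrict_space borel X)"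
    unfolding measurable_cong_sets[OF \<mu>'(2) refl]
    by (intro measurable_restrict_space2 measurable_restrict_space1)
       (auto simp: space_restrict_space X_shift)
  have eq: "{x \<in> X. P (tail (Suc j) x)} = shift -` ?E \<inter> space \<mu>"
    using X_shift by (auto simp: \<mu>'(3) shift_def)
  have "measure \<mu> {x \<in> X. P (tail (Suc j) x)} = measure (distr \<mu> (restrict_space borel X) shift) ?E"
    unfolding eq using sm E by (simp add: measure_distr)
  moreover have "{x \<in> X. P (tail (Suc j) x)} \<in> sets \<mu>"
    unfolding eq using sm E by (rule measurable_sets)
  ultimately show ?case using Suc \<mu>'(4) by simp
qed

text \<open>
  The first \<open>M + 1\<close> preimages of the event under the shift are disjoint and have equal measure.
\<close>

lemma measure_nonrecurrent_le:
  assumes X: "shift_space X" and \<mu>: "\<mu> \<in> invariant_probs X"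
    and P: "{x \<in> X. P x} \<in> sets \<mu>"
    and once: "\<And>x j k. x \<in> X \<Longrightarrow> j < k \<Longrightarrow> k \<le> M \<Longrightarrow> P (tail j x) \<Longrightarrow> \<not> P (tail k x)"
  shows "measure \<mu> {x \<in> X. P x} \<le> 1 / (real M + 1)"
proof -
  interpret prob_space \<mu> using invariant_probsD[OF \<mu>] by simp
  let ?E = "\<lambda>j. {x \<in> X. P (tail j x)}"
  have E: "?E j \<in> sets \<mu>" "measure \<mu> (?E j) = measure \<mu> {x \<in> X. P x}" for j
    using measure_tail[OF X \<mu> P] by auto
  have disj: "disjoint_family_on ?E {..M}"
    unfolding disjoint_family_on_def
  proof (intro ballI impI)
    fix j k assume "j \<in> {..M}" "k \<in> {..M}" "j \<noteq> k"
    then consider "j < k" "k \<le> M" | "k < j" "j \<le> M" by fastforce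
    then show "?E j \<inter> ?E k = {}" using once by cases blast+
  qed
  have "(real M + 1) * measure \<mu> {x \<in> X. P x} = (\<Sum>j\<in>{..M}. measure \<mu> (?E j))"
    by (simp add: E(2))
  also have "\<dots> = measure \<mu> (\<Union>j\<in>{..M}. ?E j)"
    using E(1) disj by (intro finite_measure_finite_Union[symmetric]) auto
  also have "\<dots> \<le> 1" by (rule prob_le_1)
  finally show ?thesis by (simp add: field_simps)
qed

section \<open>Uniform tightness relative to a fixed symbol\<close>

text \<open>
  If \<open>x 0 = b \<ge> B, x 1 = a\<close> happened at times \<open>j < k \<le> M\<close>, then positions \<open>j + 1, ..., k + 1\<close> would spell
  \<open>a v b a\<close>, a cycle through \<open>a\<close> of bounded length whose last symbol before closing up is \<open>b\<close>. For
  large \<open>B\<close> the assumption on cyclic predecessors excludes this. The bound \<open>B\<close> depends only on \<open>a\<close>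
  and \<open>\<epsilon>\<close>, not on the measure.
\<close>

lemma tight_predecessor:
  assumes X: "shift_space X" and F: "finite_cyclic_predecessor X" and "0 < \<epsilon>"
  obtains B where "\<And>\<mu>. \<mu> \<in> invariant_probs X \<Longrightarrow> measure \<mu> {x \<in> X. x 1 = a \<and> B \<le> x 0} \<le> \<epsilon>"
proof (cases "[a] \<in> words X 1")
  case False
  then have "{x \<in> X. x 1 = a \<and> 0 \<le> x 0} = {}"
    using block_in_words[OF X, of _ 1 1] by auto
  then have "\<And>\<mu>. measure \<mu> {x \<in> X. x 1 = a \<and> 0 \<le> x 0} \<le> \<epsilon>"
    using assms(3) by (metis less_imp_le measure_empty)
  then show ?thesis using that by blast
next
  case True
  obtain M where M: "1 / (real M + 1) \<le> \<epsilon>"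
    using assms(3) by (metis Suc_eq_plus1 less_imp_le nat_approx_posE of_nat_Suc add.commute)
  \<comment> \<open>The symbol \<open>a\<close> itself is added to rule out the loop \<open>a a\<close> of length one.\<close>
  define S where "S = insert a (\<Union>m\<in>{1..M}. predecessors X [a] \<inter> followers X m [a])"
  have "finite S"
    unfolding S_def using F True
    by (intro finite.insertI finite_UN_I) (auto simp: finite_cyclic_predecessor_def)
  then obtain B where B: "\<And>b. b \<in> S \<Longrightarrow> b < B"
    using finite_nat_set_iff_bounded by auto
  let ?P = "\<lambda>x. x 1 = a \<and> B \<le> x 0"
  have "measure \<mu> {x \<in> X. ?P x} \<le> \<epsilon>" if \<mu>: "\<mu> \<in> invariant_probs X" for \<mu>
  proof -
    have "measure \<mu> {x \<in> X. ?P x} \<le> 1 / (real M + 1)"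
    proof (rule measure_nonrecurrent_le[OF X \<mu>])
      show "{x \<in> X. ?P x} \<in> sets \<mu>" by (intro events_in_sets[OF \<mu>]) measurable
    next
      fix x j k assume x: "x \<in> X" and jk: "j < k" "k \<le> M" and j: "?P (tail j x)"
      show "\<not> ?P (tail k x)"
      proof
        assume k: "?P (tail k x)"
        have "k \<noteq> j + 1" using j k B[of a] by (auto simp: S_def)
        then have "j + 2 \<le> k" using jk by simp
        then obtain m' where k_eq: "k = j + 2 + m'" using le_Suc_ex by blast
        define m where "m = Suc m'"
        have m: "k = j + 1 + m" "1 \<le> m" "m \<le> M" using k_eq jk by (auto simp: m_def)
        have "[x k] \<in> words X 1" using block_in_words[OF X x, of k 1] by simp
        moreover have "[x k] @ [a] \<in> lang X"
          using block_in_lang[OF X x, of k 2] k by (simp add: numeral_2_eq_2)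
        ultimately have "x k \<in> predecessors X [a]" by (simp add: predecessors_def)
        moreover have "x k \<in> followers X m [a]"
        proof -
          have eq: "[j + 1..<j + 1 + Suc m] = (j + 1) # [j + 2..<k] @ [k]"
            by (subst upt_conv_Cons) (simp_all add: k_eq m_def)
          have "[a] @ map x [j + 2..<k] @ [x k] = map x [j + 1..<j + 1 + Suc m]"
            unfolding eq using j by simp
          then have "[a] @ map x [j + 2..<k] @ [x k] \<in> lang X"
            using block_in_lang[OF X x] by metis
          moreover have "map x [j + 2..<k] \<in> words X (m - 1)"
            using block_in_words[OF X x, of "j + 2" "m - 1"] m by (simp add: numeral_2_eq_2)
          ultimately show ?thesis
            using \<open>[x k] \<in> words X 1\<close> by (auto simp: followers_def)
        qed
        ultimately have "x k \<in> S" using m by (auto simp: S_def)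
        then show False using B[of "x k"] k by simp
      qed
    qed
    then show ?thesis using M by linarith
  qed
  then show ?thesis using that by blast
qed

text \<open>
  Going from \<open>k\<close> to \<open>k + 1\<close>, the symbol that precedes the prescribed \<open>a\<close> lies in a finite set up to
  measure \<open>\<epsilon> / 2\<close>, and the induction hypothesis applies to each symbol of this finite set.
\<close>

lemma tight_backwards:
  assumes X: "shift_space X" and F: "finite_cyclic_predecessor X" and "0 < \<epsilon>"
  shows "\<exists>B. \<forall>\<mu>\<in>invariant_probs X. measure \<mu> {x \<in> X. x k = a \<and> B \<le> x 0} \<le> \<epsilon>"
  using \<open>0 < \<epsilon>\<close>
proof (induction k arbitrary: a \<epsilon>)
  case 0
  have "{x \<in> X. x 0 = a \<and> Suc a \<le> x 0} = {}" by auto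
  then have "measure \<mu> {x \<in> X. x 0 = a \<and> Suc a \<le> x 0} \<le> \<epsilon>" for \<mu>
    using 0 by (simp only: measure_empty)
  then show ?case by blast
next
  case (Suc k)
  obtain C where C: "\<And>\<mu>. \<mu> \<in> invariant_probs X \<Longrightarrow> measure \<mu> {x \<in> X. x 1 = a \<and> C \<le> x 0} \<le> \<epsilon> / 2"
    using tight_predecessor[OF X F, of "\<epsilon> / 2"] Suc.prems by auto
  have "\<forall>c. \<exists>B. \<forall>\<mu>\<in>invariant_probs X. measure \<mu> {x \<in> X. x k = c \<and> B \<le> x 0} \<le> \<epsilon> / (2 * (real C + 1))"
    using Suc.IH Suc.prems by simp
  from choice[OF this] obtain B where B: "\<And>c \<mu>. \<mu> \<in> invariant_probs X \<Longrightarrow>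
      measure \<mu> {x \<in> X. x k = c \<and> B c \<le> x 0} \<le> \<epsilon> / (2 * (real C + 1))"
    by blast
  define D where "D = (\<Sum>c<C. B c)"
  have "measure \<mu> {x \<in> X. x (Suc k) = a \<and> D \<le> x 0} \<le> \<epsilon>" if \<mu>: "\<mu> \<in> invariant_probs X" for \<mu>
  proof -
    interpret prob_space \<mu> using invariant_probsD[OF \<mu>] by simp
    note ev = events_in_sets[OF \<mu>]
    let ?E = "{x \<in> X. x (1 + k) = a \<and> C \<le> x (0 + k)}"
    let ?G = "\<lambda>c. {x \<in> X. x k = c \<and> B c \<le> x 0}"
    have DB: "B c \<le> D" if "c < C" for c
      unfolding D_def using that by (intro member_le_sum) auto
    have "x \<in> ?E \<union> (\<Union>c<C. ?G c)" if "x \<in> X" "x (Suc k) = a" "D \<le> x 0" for x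
      using that DB[of "x k"] by (cases "x k < C") auto
    then have "{x \<in> X. x (Suc k) = a \<and> D \<le> x 0} \<subseteq> ?E \<union> (\<Union>c<C. ?G c)"
      by blast
    then have "prob {x \<in> X. x (Suc k) = a \<and> D \<le> x 0} \<le> prob (?E \<union> (\<Union>c<C. ?G c))"
      by (intro finite_measure_mono sets.Un sets.finite_UN ev finite_lessThan; measurable)
    also have "\<dots> \<le> prob ?E + prob (\<Union>c<C. ?G c)"
      by (intro measure_Un_le sets.finite_UN ev finite_lessThan; measurable)
    also have "prob (\<Union>c<C. ?G c) \<le> (\<Sum>c<C. prob (?G c))"
      by (intro measure_UNION_le ev finite_lessThan; measurable)
    also have "\<dots> \<le> (\<Sum>c<C. \<epsilon> / (2 * (real C + 1)))"
      by (intro sum_mono B \<mu>)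
    also have "\<dots> \<le> \<epsilon> / 2" using Suc.prems by (simp add: field_simps)
    also have "prob ?E \<le> \<epsilon> / 2"
      using C[OF \<mu>] measure_tail[OF X \<mu> ev, of "\<lambda>x. x 1 = a \<and> C \<le> x 0" k] by simp
    finally show ?thesis by simp
  qed
  then show ?case by blast
qed

text \<open>
  The assumption on \<open>X\<close> restricts predecessors only; successors are controlled through recurrence. A
  point of \<open>[a]\<close> fails to return to \<open>[a]\<close> within \<open>M\<close> steps only on a set of measure at most
  \<open>1 / (M + 1)\<close>, and
  if it returns at time \<open>m\<close>, then \<open>x 1\<close> is tied to the later symbol \<open>x m = a\<close>, so that the backward
  estimate applies.
\<close>

lemma tight_successor:
  assumes X: "shift_space X" and F: "finite_cyclic_predecessor X" and "0 < \<epsilon>"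
  obtains B where "\<And>\<mu>. \<mu> \<in> invariant_probs X \<Longrightarrow> measure \<mu> {x \<in> X. x 0 = a \<and> B \<le> x 1} \<le> \<epsilon>"
proof -
  obtain M where "inverse (real (Suc M)) < \<epsilon> / 2"
    using reals_Archimedean[of "\<epsilon> / 2"] assms(3) by auto
  then have M: "1 / (real M + 1) \<le> \<epsilon> / 2" by (simp add: inverse_eq_divide add.commute)
  have "\<forall>k. \<exists>B. \<forall>\<mu>\<in>invariant_probs X. measure \<mu> {x \<in> X. x k = a \<and> B \<le> x 0} \<le> \<epsilon> / (2 * (real M + 1))"
    using tight_backwards[OF X F] assms(3) by simp
  from choice[OF this] obtain B where B: "\<And>k \<mu>. \<mu> \<in> invariant_probs X \<Longrightarrow>
      measure \<mu> {x \<in> X. x k = a \<and> B k \<le> x 0} \<le> \<epsilon> / (2 * (real M + 1))"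
    by blast
  define D where "D = (\<Sum>c<M. B c)"
  have "measure \<mu> {x \<in> X. x 0 = a \<and> D \<le> x 1} \<le> \<epsilon>" if \<mu>: "\<mu> \<in> invariant_probs X" for \<mu>
  proof -
    interpret prob_space \<mu> using invariant_probsD[OF \<mu>] by simp
    note ev = events_in_sets[OF \<mu>]
    \<comment> \<open>Points that do not return to \<open>a\<close> in time, and points that are at \<open>a\<close> again at time \<open>k + 1\<close>.\<close>
    let ?N = "{x \<in> X. x 0 = a \<and> (\<forall>m\<in>{1..M}. x m \<noteq> a)}"
    let ?G = "\<lambda>k. {x \<in> X. x (k + 1) = a \<and> B k \<le> x (0 + 1)}"
    have DB: "B c \<le> D" if "c < M" for c
      unfolding D_def using that by (intro member_le_sum) auto
    have "{x \<in> X. x 0 = a \<and> D \<le> x 1} \<subseteq> ?N \<union> (\<Union>k<M. ?G k)"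
    proof
      fix x assume x: "x \<in> {x \<in> X. x 0 = a \<and> D \<le> x 1}"
      show "x \<in> ?N \<union> (\<Union>k<M. ?G k)"
      proof (cases "\<forall>m\<in>{1..M}. x m \<noteq> a")
        case False
        then obtain k where "k < M" "x (k + 1) = a"
          by (metis Suc_eq_plus1 Suc_le_lessD Suc_pred' atLeastAtMost_iff less_eq_Suc_le One_nat_def)
        then have "x \<in> ?G k" using x DB[of k] by auto
        then show ?thesis using \<open>k < M\<close> by blast
      qed (use x in auto)
    qed
    then have "prob {x \<in> X. x 0 = a \<and> D \<le> x 1} \<le> prob (?N \<union> (\<Union>c<M. ?G c))"
      by (intro finite_measure_mono sets.Un sets.finite_UN ev finite_lessThan; measurable)
    also have "\<dots> \<le> prob ?N + prob (\<Union>c<M. ?G c)"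
      by (intro measure_Un_le sets.finite_UN ev finite_lessThan; measurable)
    also have "prob (\<Union>c<M. ?G c) \<le> (\<Sum>c<M. prob (?G c))"
      by (intro measure_UNION_le ev finite_lessThan; measurable)
    also have "\<dots> \<le> (\<Sum>c<M. \<epsilon> / (2 * (real M + 1)))"
    proof (intro sum_mono)
      fix k
      have "prob (?G k) = prob {x \<in> X. x k = a \<and> B k \<le> x 0}"
        using measure_tail[OF X \<mu> ev, of "\<lambda>x. x k = a \<and> B k \<le> x 0" 1] by simp
      then show "prob (?G k) \<le> \<epsilon> / (2 * (real M + 1))" using B[OF \<mu>, of k] by simp
    qed
    also have "\<dots> \<le> \<epsilon> / 2" using assms(3) by (simp add: field_simps)
    also have "prob ?N \<le> 1 / (real M + 1)"
    proof (rule measure_nonrecurrent_le[OF X \<mu>])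
      fix x j k assume "j < k" "k \<le> M"
        and j: "tail j x 0 = a \<and> (\<forall>m\<in>{1..M}. tail j x m \<noteq> a)"
      then have "k - j \<in> {1..M}" by auto
      then have "tail j x (k - j) \<noteq> a" using j by blast
      then show "\<not> (tail k x 0 = a \<and> (\<forall>m\<in>{1..M}. tail k x m \<noteq> a))"
        using \<open>j < k\<close> by simp
    qed (intro ev; measurable)
    finally show ?thesis using M by simp
  qed
  then show ?thesis using that by blast
qed

section \<open>Cylinders generate the Borel sets\<close>

lemma cylinder_eq_Int: "cylinder X w = X \<inter> cylinder UNIV w"
  by (auto simp: cylinder_def)

lemma in_own_cylinder: "x \<in> X \<Longrightarrow> x \<in> cylinder X (map x [0..<k])"
  by (simp add: cylinder_def)

lemma in_cylinder_iff:
  assumes "length w = k"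
  shows "x \<in> cylinder X w \<longleftrightarrow> x \<in> X \<and> map x [0..<k] = w"
  using assms by (auto simp: cylinder_def list_eq_iff_nth_eq)

lemma cylinder_in_sets:
  assumes "\<mu> \<in> invariant_probs X"
  shows "cylinder X w \<in> sets \<mu>"
  unfolding cylinder_def by (intro events_in_sets[OF assms]) measurable

lemma open_cylinder_sets: "cylinder UNIV w \<in> sets borel"
proof -
  have "{x \<in> space (borel :: (nat \<Rightarrow> nat) measure). \<forall>i<length w. x i = w ! i} \<in> sets borel"
    by measurable
  then show ?thesis by (simp add: cylinder_def)
qed

lemma cylinder_basis:
  assumes "open U" "x \<in> U"
  obtains k where "cylinder UNIV (map x [0..<k]) \<subseteq> U"
proof -
  have "openin (product_topology (\<lambda>_. euclidean) UNIV) U"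
    using assms(1) by (simp add: open_fun_def)
  then obtain V where V: "x \<in> PiE UNIV V" "finite {i. V i \<noteq> UNIV}" "PiE UNIV V \<subseteq> U"
    using product_topology_open_contains_basis[of "\<lambda>_. euclidean" UNIV U x] assms(2) by auto
  obtain k where k: "\<And>i. V i \<noteq> UNIV \<Longrightarrow> i < k"
    using V(2) by (auto simp: finite_nat_set_iff_bounded)
  have "cylinder UNIV (map x [0..<k]) \<subseteq> PiE UNIV V"
  proof
    fix y assume "y \<in> cylinder UNIV (map x [0..<k])"
    then have "y i = x i" if "i < k" for i using that by (simp add: cylinder_def)
    then have "y i \<in> V i" for i using V(1) k[of i] by (cases "i < k") auto
    then show "y \<in> PiE UNIV V" by auto
  qed
  then show ?thesis using that V(3) by blast
qed

lemma borel_eq_sigma_cylinders: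
  "sets borel = sigma_sets UNIV (insert {} (range (cylinder UNIV)))"
  unfolding sets_borel
proof (rule sigma_sets_eqI)
  fix U :: "(nat \<Rightarrow> nat) set" assume "U \<in> {S. open S}"
  then have U: "open U" by simp
  have "U = \<Union> {cylinder UNIV w |w. cylinder UNIV w \<subseteq> U}"
  proof (intro equalityI subsetI)
    fix x assume "x \<in> U"
    then obtain k where "cylinder UNIV (map x [0..<k]) \<subseteq> U" using cylinder_basis[OF U] by blast
    then show "x \<in> \<Union> {cylinder UNIV w |w. cylinder UNIV w \<subseteq> U}"
      using in_own_cylinder[of x UNIV k] by auto
  qed auto
  moreover have "\<Union> {cylinder UNIV w |w. cylinder UNIV w \<subseteq> U}
      \<in> sigma_sets UNIV (insert {} (range (cylinder UNIV)))"
    by (intro sigma_sets_UNION) (auto simp: setcompr_eq_image intro: sigma_sets.Basic)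
  ultimately show "U \<in> sigma_sets UNIV (insert {} (range (cylinder UNIV)))" by simp
next
  fix C :: "(nat \<Rightarrow> nat) set" assume "C \<in> insert {} (range (cylinder UNIV))"
  then show "C \<in> sigma_sets UNIV {S. open S}"
    using open_cylinder_sets unfolding sets_borel by (auto intro: sigma_sets.Empty)
qed

lemma cylinder_Int_cylinder:
  "cylinder UNIV v \<inter> cylinder UNIV w \<in> insert {} (range (cylinder UNIV))"
proof -
  have *: "cylinder UNIV v \<inter> cylinder UNIV w \<in> insert {} (range (cylinder UNIV))"
    if "length v \<le> length w" for v w
  proof (cases "\<forall>i<length v. w ! i = v ! i")
    case True
    then have "cylinder UNIV v \<inter> cylinder UNIV w = cylinder UNIV w"
      using that by (auto simp: cylinder_def)
    then show ?thesis by blast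
  next
    case False
    then have "cylinder UNIV v \<inter> cylinder UNIV w = {}"
      using that by (auto simp: cylinder_def)
    then show ?thesis by blast
  qed
  show ?thesis
    using *[of v w] *[of w v] by (cases "length v \<le> length w") (auto simp: Int_commute)
qed

lemma borel_prob_eqI:
  fixes M N :: "(nat \<Rightarrow> nat) measure"
  assumes M: "prob_space M" "sets M = sets borel" and N: "prob_space N" "sets N = sets borel"
    and eq: "\<And>w. w \<noteq> [] \<Longrightarrow> measure M (cylinder UNIV w) = measure N (cylinder UNIV w)"
  shows "M = N"
proof (rule measure_eqI_generator_eq)
  interpret M: prob_space M by fact
  interpret N: prob_space N by fact
  have sp: "space M = UNIV" "space N = UNIV"
    using M(2) N(2) by (auto dest: sets_eq_imp_space_eq)
  show "Int_stable (insert {} (range (cylinder UNIV)))"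
    using cylinder_Int_cylinder by (auto simp: Int_stable_def)
  show "insert {} (range (cylinder UNIV)) \<subseteq> Pow UNIV" by auto
  have "measure M (cylinder UNIV w) = measure N (cylinder UNIV w)" for w
    using eq[of w] M.prob_space N.prob_space sp by (cases "w = []") (auto simp: cylinder_def)
  then show "emeasure M C = emeasure N C" if "C \<in> insert {} (range (cylinder UNIV))" for C
    using that by (auto simp: M.emeasure_eq_measure N.emeasure_eq_measure)
  show "sets M = sigma_sets UNIV (insert {} (range (cylinder UNIV)))"
    "sets N = sigma_sets UNIV (insert {} (range (cylinder UNIV)))"
    using M(2) N(2) borel_eq_sigma_cylinders by auto
  show "range (\<lambda>_ :: nat. UNIV :: (nat \<Rightarrow> nat) set) \<subseteq> insert {} (range (cylinder UNIV))"
    by (auto simp: cylinder_def image_iff intro!: exI[of _ "[]"])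
  show "emeasure M UNIV \<noteq> \<infinity>" by simp
qed simp

section \<open>Limits of cylinder measures\<close>

text \<open>
  Dominated convergence for series, with uniformly small tails in place of a dominating series.
\<close>

lemma tight_limit_sums:
  fixes f :: "nat \<Rightarrow> nat \<Rightarrow> real"
  assumes nonneg: "\<And>n b. 0 \<le> f n b"
    and sums: "\<And>n. f n sums F n"
    and g: "\<And>b. (\<lambda>n. f n b) \<longlonglongrightarrow> g b" and G: "F \<longlonglongrightarrow> G"
    and tight: "\<And>\<epsilon>. 0 < \<epsilon> \<Longrightarrow> \<exists>B. \<forall>n. F n - (\<Sum>b<B. f n b) \<le> \<epsilon>"
  shows "g sums G"
  unfolding sums_def
proof (rule LIMSEQ_I)
  fix \<epsilon> :: real assume "0 < \<epsilon>"
  then obtain B where B: "\<And>n. F n - (\<Sum>b<B. f n b) \<le> \<epsilon> / 2"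
    using tight[of "\<epsilon> / 2"] by auto
  have partial: "(\<lambda>n. F n - (\<Sum>b<N. f n b)) \<longlonglongrightarrow> G - (\<Sum>b<N. g b)" for N
    by (intro tendsto_intros G g)
  have "norm ((\<Sum>b<N. g b) - G) < \<epsilon>" if "B \<le> N" for N
  proof -
    have "0 \<le> F n - (\<Sum>b<N. f n b)" for n
      using sum_le_suminf[OF sums_summable[OF sums], of "{..<N}" n] nonneg sums_unique[OF sums, of n]
      by simp
    then have "0 \<le> G - (\<Sum>b<N. g b)"
      by (intro LIMSEQ_le_const[OF partial]) auto
    moreover have "F n - (\<Sum>b<N. f n b) \<le> \<epsilon> / 2" for n
      using B[of n] sum_mono2[of "{..<N}" "{..<B}" "f n"] nonneg that by force
    then have "G - (\<Sum>b<N. g b) \<le> \<epsilon> / 2"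
      by (intro LIMSEQ_le_const2[OF partial]) auto
    ultimately show ?thesis using \<open>0 < \<epsilon>\<close> by simp
  qed
  then show "\<exists>no. \<forall>n\<ge>no. norm ((\<Sum>b<n. g b) - G) < \<epsilon>" by blast
qed

text \<open>
  Tychonoff's theorem for the cube; a countable product is metrizable, so compactness is sequential.
\<close>

lemma pointwise_convergent_subsequence:
  fixes f :: "nat \<Rightarrow> 'a::countable \<Rightarrow> real"
  assumes "\<And>n w. f n w \<in> {0..1}"
  shows "\<exists>r g. strict_mono (r :: nat \<Rightarrow> nat) \<and> (\<forall>w. (\<lambda>n. f (r n) w) \<longlonglongrightarrow> g w)"
proof -
  let ?S = "PiE UNIV (\<lambda>_. {0..1}) :: ('a \<Rightarrow> real) set"
  have "compactin (product_topology (\<lambda>_. euclidean) UNIV) ?S"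
    by (subst compactin_PiE) auto
  then have "compact ?S"
    by (simp add: euclidean_product_topology)
  then have "seq_compact ?S" by (rule compact_imp_seq_compact)
  moreover have "\<forall>n. f n \<in> ?S" using assms by auto
  ultimately obtain g r where r: "strict_mono (r :: nat \<Rightarrow> nat)" "(f \<circ> r) \<longlonglongrightarrow> g"
    by (rule seq_compactE)
  have "(\<lambda>n. f (r n) w) \<longlonglongrightarrow> g w" for w
    using continuous_on_tendsto_compose[OF continuous_on_product_coordinates r(2), of w]
    by (simp add: comp_def)
  then show ?thesis using r(1) by blast
qed

lemma split_by_letter:
  assumes \<mu>: "\<mu> \<in> invariant_probs X" and P: "Measurable.pred borel P"
  shows "(\<lambda>b. measure \<mu> {x \<in> X. P x \<and> x k = b}) sums measure \<mu> {x \<in> X. P x}" (is ?sums)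
    and "measure \<mu> {x \<in> X. P x} - (\<Sum>b<B. measure \<mu> {x \<in> X. P x \<and> x k = b}) =
      measure \<mu> {x \<in> X. P x \<and> B \<le> x k}" (is ?tail)
proof -
  interpret prob_space \<mu> using invariant_probsD[OF \<mu>] by simp
  note ev = events_in_sets[OF \<mu>] and [measurable] = P
  have E: "{x \<in> X. P x \<and> x k = b} \<in> sets \<mu>" for b by (intro ev; measurable)
  have "{x \<in> X. P x} = (\<Union>b. {x \<in> X. P x \<and> x k = b})" by auto
  then show ?sums using E
    by (simp, intro finite_measure_UNION) (auto simp: disjoint_family_on_def)
  have "(\<Sum>b<B. measure \<mu> {x \<in> X. P x \<and> x k = b}) = measure \<mu> (\<Union>b<B. {x \<in> X. P x \<and> x k = b})"
    by (intro finite_measure_finite_Union[symmetric]) (auto simp: E disjoint_family_on_def)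
  moreover have "(\<Union>b<B. {x \<in> X. P x \<and> x k = b}) = {x \<in> X. P x} - {x \<in> X. P x \<and> B \<le> x k}"
    by auto
  moreover have "measure \<mu> ({x \<in> X. P x} - {x \<in> X. P x \<and> B \<le> x k}) =
      measure \<mu> {x \<in> X. P x} - measure \<mu> {x \<in> X. P x \<and> B \<le> x k}"
    by (intro finite_measure_Diff ev) (measurable, auto)
  ultimately show ?tail by simp
qed

lemma measure_letters_less:
  assumes \<mu>: "\<mu> \<in> invariant_probs X"
  shows "measure \<mu> {x \<in> X. x 0 < B} = (\<Sum>i<B. measure \<mu> (cylinder X [i]))"
proof -
  interpret prob_space \<mu> using invariant_probsD(1)[OF \<mu>] .
  have "{x \<in> X. x 0 < B} = (\<Union>i<B. cylinder X [i])" by (auto simp: cylinder_def)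
  also have "measure \<mu> \<dots> = (\<Sum>i<B. measure \<mu> (cylinder X [i]))"
  proof (rule finite_measure_finite_Union)
    show "disjoint_family_on (\<lambda>i. cylinder X [i]) {..<B}"
      by (auto simp: disjoint_family_on_def cylinder_def)
  qed (use cylinder_in_sets[OF \<mu>] in auto)
  finally show ?thesis .
qed

text \<open>
  Consistency fails in general for the empty word: this is exactly the mass that escapes. For a
  nonempty word the tightness relative to its last, respectively first, symbol lets the limit pass
  through the sum over all extensions.
\<close>

lemma cylinder_limit:
  assumes X: "shift_space X" and F: "finite_cyclic_predecessor X"
    and \<mu>: "\<And>n. \<mu> n \<in> invariant_probs X"
  obtains r m where "strict_mono (r :: nat \<Rightarrow> nat)"
    "\<And>w. (\<lambda>n. measure (\<mu> (r n)) (cylinder X w)) \<longlonglongrightarrow> m w"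
    "\<And>w. w \<noteq> [] \<Longrightarrow> (\<lambda>b. m (w @ [b])) sums m w"
    "\<And>w. w \<noteq> [] \<Longrightarrow> (\<lambda>b. m (b # w)) sums m w"
proof -
  have unit: "measure (\<mu> n) (cylinder X w) \<in> {0..1}" for n w
    using prob_space.prob_le_1[OF invariant_probsD(1)[OF \<mu>]] by simp
  have "\<exists>r m. strict_mono (r :: nat \<Rightarrow> nat) \<and> (\<forall>w. (\<lambda>n. measure (\<mu> (r n)) (cylinder X w)) \<longlonglongrightarrow> m w)"
    by (rule pointwise_convergent_subsequence) (rule unit)
  then obtain r m where r: "strict_mono (r :: nat \<Rightarrow> nat)"
    and m: "\<And>w. (\<lambda>n. measure (\<mu> (r n)) (cylinder X w)) \<longlonglongrightarrow> m w"
    by blast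
  show ?thesis
  proof (rule that[OF r m])
    fix w :: "nat list" assume "w \<noteq> []"
    let ?P = "\<lambda>x. \<forall>i<length w. x i = w ! i" and ?k = "length w"
    let ?P' = "\<lambda>x. \<forall>i<length w. x (i + 1) = w ! i"
    have P: "Measurable.pred borel ?P" "Measurable.pred borel ?P'" by measurable
    have cyl: "cylinder X w = {x \<in> X. ?P x}" by (simp add: cylinder_def)
    have snoc: "cylinder X (w @ [b]) = {x \<in> X. ?P x \<and> x ?k = b}" for b
      by (auto simp: cylinder_def nth_append less_Suc_eq)
    have cons: "cylinder X (b # w) = {x \<in> X. ?P' x \<and> x 0 = b}" for b
      by (auto simp: cylinder_def less_Suc_eq_0_disj)
    have tail1: "measure (\<mu> n) {x \<in> X. ?P' x} = measure (\<mu> n) (cylinder X w)" for n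
      unfolding cyl by (rule conjunct2[OF measure_tail[OF X \<mu> events_in_sets[OF \<mu> P(1)]]])
    have mono: "measure (\<mu> n) {x \<in> X. R x} \<le> measure (\<mu> n) {x \<in> X. S x}"
      if "\<And>x. x \<in> X \<Longrightarrow> R x \<Longrightarrow> S x" "Measurable.pred borel S" for R S n
      using that events_in_sets[OF \<mu> that(2)] invariant_probsD(1)[OF \<mu>]
      by (intro finite_measure.finite_measure_mono) (auto simp: prob_space_def)
    show "(\<lambda>b. m (w @ [b])) sums m w"
    proof (rule tight_limit_sums[OF _ _ m m])
      show "(\<lambda>b. measure (\<mu> (r n)) (cylinder X (w @ [b]))) sums measure (\<mu> (r n)) (cylinder X w)" for n
        unfolding snoc cyl by (rule split_by_letter(1)[OF \<mu> P(1)])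
      fix \<epsilon> :: real assume "0 < \<epsilon>"
      then obtain B where B: "\<And>\<mu>. \<mu> \<in> invariant_probs X \<Longrightarrow>
          measure \<mu> {x \<in> X. x 0 = last w \<and> B \<le> x 1} \<le> \<epsilon>"
        using tight_successor[OF X F, where a = "last w"] by blast
      have "measure (\<mu> n) {x \<in> X. ?P x \<and> B \<le> x ?k} \<le> \<epsilon>" for n
      proof -
        have "measure (\<mu> n) {x \<in> X. ?P x \<and> B \<le> x ?k} \<le>
            measure (\<mu> n) {x \<in> X. x (0 + (?k - 1)) = last w \<and> B \<le> x (1 + (?k - 1))}"
          using \<open>w \<noteq> []\<close> by (intro mono) (auto simp: last_conv_nth)
        also have "\<dots> = measure (\<mu> n) {x \<in> X. x 0 = last w \<and> B \<le> x 1}"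
          using measure_tail[OF X \<mu>[of n] events_in_sets[OF \<mu>[of n]],
              of "\<lambda>x. x 0 = last w \<and> B \<le> x 1" "?k - 1"] by simp
        finally show ?thesis using B[OF \<mu>, of n] by simp
      qed
      then show "\<exists>B. \<forall>n. measure (\<mu> (r n)) (cylinder X w)
          - (\<Sum>b<B. measure (\<mu> (r n)) (cylinder X (w @ [b]))) \<le> \<epsilon>"
        unfolding snoc cyl split_by_letter(2)[OF \<mu> P(1)] by blast
    qed simp
    show "(\<lambda>b. m (b # w)) sums m w"
    proof (rule tight_limit_sums[OF _ _ m m])
      show "(\<lambda>b. measure (\<mu> (r n)) (cylinder X (b # w))) sums measure (\<mu> (r n)) (cylinder X w)" for n
        unfolding cons tail1[symmetric] by (rule split_by_letter(1)[OF \<mu> P(2)])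
      fix \<epsilon> :: real assume "0 < \<epsilon>"
      then obtain B where B: "\<And>\<mu>. \<mu> \<in> invariant_probs X \<Longrightarrow>
          measure \<mu> {x \<in> X. x 1 = hd w \<and> B \<le> x 0} \<le> \<epsilon>"
        using tight_predecessor[OF X F, where a = "hd w"] by blast
      have "measure (\<mu> n) {x \<in> X. ?P' x \<and> B \<le> x 0} \<le> \<epsilon>" for n
      proof -
        have "measure (\<mu> n) {x \<in> X. ?P' x \<and> B \<le> x 0} \<le>
            measure (\<mu> n) {x \<in> X. x 1 = hd w \<and> B \<le> x 0}"
          using \<open>w \<noteq> []\<close> by (intro mono) (auto simp: hd_conv_nth)
        then show ?thesis using B[OF \<mu>, of n] by simp
      qed
      then show "\<exists>B. \<forall>n. measure (\<mu> (r n)) (cylinder X w)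
          - (\<Sum>b<B. measure (\<mu> (r n)) (cylinder X (b # w))) \<le> \<epsilon>"
        unfolding cons tail1[symmetric] split_by_letter(2)[OF \<mu> P(2)] by blast
    qed simp
  qed
qed

section \<open>A measure with prescribed cylinder probabilities\<close>

text \<open>
  Kolmogorov's extension theorem. The word laws are built letter by letter from conditional
  probabilities, which makes their mutual consistency immediate.
\<close>

lemma measure_with_cylinder_probabilities:
  fixes p :: "nat list \<Rightarrow> real"
  assumes p0: "p [] = 1" and nonneg: "\<And>w. 0 \<le> p w"
    and sums: "\<And>w. (\<lambda>b. p (w @ [b])) sums p w"
  obtains N where "prob_space N" "sets N = sets (borel :: (nat \<Rightarrow> nat) measure)"
    "\<And>w. measure N (cylinder UNIV w) = p w"
proof -
  \<comment> \<open>\<open>K w\<close> is the law of the next letter after \<open>w\<close>, and \<open>Q k\<close> the law of the first \<open>k\<close> letters.\<close>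
  define K where "K w = embed_pmf (\<lambda>b. p (w @ [b]) / p w)" for w
  define Q where "Q = rec_nat (return_pmf []) (\<lambda>_ q. bind_pmf q (\<lambda>w. map_pmf (\<lambda>b. w @ [b]) (K w)))"
  have Q0: "Q 0 = return_pmf []"
    and QSuc: "Q (Suc k) = bind_pmf (Q k) (\<lambda>w. map_pmf (\<lambda>b. w @ [b]) (K w))" for k
    by (simp_all add: Q_def)

  have K: "pmf (K w) b = p (w @ [b]) / p w" if "0 < p w" for w b
    unfolding K_def
  proof (rule pmf_embed_pmf)
    have "(\<lambda>b. p (w @ [b]) / p w) sums (p w / p w)" by (intro sums_divide sums)
    then have *: "(\<lambda>b. p (w @ [b]) / p w) sums 1" using that by simp
    have "(\<integral>\<^sup>+ b. ennreal (p (w @ [b]) / p w) \<partial>count_space UNIV) = (\<Sum>b. ennreal (p (w @ [b]) / p w))"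
      by (rule nn_integral_count_space_nat)
    also have "\<dots> = ennreal 1"
      using * nonneg by (subst suminf_ennreal2) (auto simp: sums_iff)
    finally show "(\<integral>\<^sup>+ b. ennreal (p (w @ [b]) / p w) \<partial>count_space UNIV) = 1" by simp
  qed (use nonneg in simp)

  have length_Q: "length w = k" if "w \<in> set_pmf (Q k)" for w k
    using that by (induction k arbitrary: w) (auto simp: Q0 QSuc)

  have pmf_Q: "pmf (Q (length w)) w = p w" for w
  proof (induction w rule: rev_induct)
    case Nil
    then show ?case by (simp add: Q0 p0)
  next
    case (snoc b w)
    have "pmf (map_pmf (\<lambda>b. v @ [b]) (K v)) (w @ [b]) = indicator {w} v * pmf (K w) b" for v
    proof (cases "v = w")
      case True
      have "pmf (map_pmf (\<lambda>b. w @ [b]) (K w)) (w @ [b]) = pmf (K w) b"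
        using pmf_map_inj'[of "\<lambda>b. w @ [b]" "K w" b] by (simp add: inj_on_def)
      then show ?thesis using True by simp
    next
      case False
      then have "w @ [b] \<notin> set_pmf (map_pmf (\<lambda>b. v @ [b]) (K v))" by auto
      then show ?thesis using False by (simp add: pmf_eq_0_set_pmf del: set_map_pmf)
    qed
    then have "pmf (Q (length (w @ [b]))) (w @ [b]) = pmf (Q (length w)) w * pmf (K w) b"
      by (simp add: QSuc pmf_bind measure_pmf_single)
    also have "\<dots> = p (w @ [b])"
    proof (cases "p w = 0")
      case True
      have "p (w @ [b]) \<le> (\<Sum>b. p (w @ [b]))"
        using sum_le_suminf[OF sums_summable[OF sums], of "{b}" w] nonneg by simp
      then have "p (w @ [b]) = 0"
        using True nonneg[of "w @ [b]"] sums_unique[OF sums, of w] by simp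
      then show ?thesis using True snoc by simp
    next
      case False
      then show ?thesis using snoc nonneg[of w] by (simp add: K)
    qed
    finally show ?case .
  qed

  have take_Q: "map_pmf (take k) (Q (k + j)) = Q k" for k j
  proof (induction j)
    case 0
    have "map_pmf (take k) (Q k) = map_pmf id (Q k)"
      by (intro map_pmf_cong) (auto dest: length_Q)
    then show ?case by simp
  next
    case (Suc j)
    have "map_pmf (take k) (Q (Suc (k + j))) =
        bind_pmf (Q (k + j)) (\<lambda>w. map_pmf (\<lambda>b. take k (w @ [b])) (K w))"
      by (simp add: QSuc map_bind_pmf pmf.map_comp comp_def)
    also have "\<dots> = bind_pmf (Q (k + j)) (\<lambda>w. return_pmf (take k w))"
      by (intro bind_pmf_cong) (auto dest: length_Q)
    also have "\<dots> = map_pmf (take k) (Q (k + j))" by (simp add: map_pmf_def)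
    finally show ?case using Suc by simp
  qed

  \<comment> \<open>The marginal on a finite set \<open>J\<close> of coordinates is read off from a word long enough to cover
    \<open>J\<close>. The projective limit is taken over the Polish space of reals, into which letters are
    embedded; \<open>R\<close> below maps them back.\<close>
  define bound where "bound J = (\<Sum>j\<in>J. Suc j)" for J :: "nat set"
  have less_bound: "j < bound J" if "finite J" "j \<in> J" for j J
    unfolding bound_def using member_le_sum[of j J Suc] that by simp
  define val where "val J w = (\<lambda>j\<in>J. real (w ! j))" for J w
  have val_take: "val J (take k w) = val J w" if "\<And>j. j \<in> J \<Longrightarrow> j < k" for J k w
    using that by (auto simp: val_def)
  define P where "P J = distr (measure_pmf (Q (bound J))) (\<Pi>\<^sub>M j\<in>J. borel) (val J)" for J
  have val_meas: "val J \<in> measurable (measure_pmf (Q k)) (\<Pi>\<^sub>M j\<in>J. borel)" for J k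
    by (auto simp: val_def space_PiM)
  have P_eq: "P J = distr (measure_pmf (Q k)) (\<Pi>\<^sub>M j\<in>J. borel) (val J)"
    if J: "finite J" and k: "bound J \<le> k" for J k
  proof -
    obtain i where i: "k = bound J + i" using k le_Suc_ex by blast
    have "P J = distr (distr (measure_pmf (Q k)) (count_space UNIV) (take (bound J))) (\<Pi>\<^sub>M j\<in>J. borel) (val J)"
      unfolding P_def map_pmf_rep_eq[symmetric] i take_Q ..
    also have "\<dots> = distr (measure_pmf (Q k)) (\<Pi>\<^sub>M j\<in>J. borel) (val J \<circ> take (bound J))"
      by (intro distr_distr) (auto simp: val_def space_PiM)
    also have "val J \<circ> take (bound J) = val J"
      using less_bound[OF J] by (auto simp: fun_eq_iff val_take)
    finally show ?thesis .
  qed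

  interpret L: polish_projective UNIV P
  proof (intro polish_projective.intro projective_family.intro)
    fix J H :: "nat set" assume JH: "J \<subseteq> H" "finite H" "H \<subseteq> UNIV"
    then have J: "finite J" by (auto intro: finite_subset)
    have "bound J \<le> bound H" unfolding bound_def using JH by (intro sum_mono2) auto
    then have "P J = distr (measure_pmf (Q (bound H))) (\<Pi>\<^sub>M j\<in>J. borel) (val J)"
      by (rule P_eq[OF J])
    also have "val J = (\<lambda>f. restrict f J) \<circ> val H"
      using JH by (auto simp: val_def fun_eq_iff)
    also have "distr (measure_pmf (Q (bound H))) (\<Pi>\<^sub>M j\<in>J. borel) ((\<lambda>f. restrict f J) \<circ> val H) =
        distr (P H) (\<Pi>\<^sub>M j\<in>J. borel) (\<lambda>f. restrict f J)"
      unfolding P_def using JH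
      by (intro distr_distr[symmetric] val_meas measurable_restrict_subset)
    finally show "P J = distr (P H) (\<Pi>\<^sub>M j\<in>J. borel) (\<lambda>f. restrict f J)" .
  next
    fix J :: "nat set"
    show "prob_space (P J)"
      unfolding P_def by (intro prob_space.prob_space_distr val_meas prob_space_measure_pmf)
  qed

  define R where "R f = (\<lambda>n::nat. nat \<lfloor>f n :: real\<rfloor>)" for f
  have "R \<in> measurable (PiM UNIV (\<lambda>_. borel)) (PiM UNIV (\<lambda>_. borel))"
    unfolding R_def
  proof (intro measurable_abs_UNIV)
    fix n :: nat
    have "(\<lambda>f :: nat \<Rightarrow> real. nat \<lfloor>f n\<rfloor>) \<in> measurable (PiM UNIV (\<lambda>_. borel)) (count_space UNIV)"
      by measurable
    then show "(\<lambda>f :: nat \<Rightarrow> real. nat \<lfloor>f n\<rfloor>) \<in> borel_measurable (PiM UNIV (\<lambda>_. borel))"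
      by (simp add: measurable_cong_sets[OF refl sets_borel_eq_count_space])
  qed
  then have R: "R \<in> measurable L.lim borel"
    by (simp add: measurable_cong_sets[OF L.sets_lim sets_PiM_equal_borel[symmetric]])
  define N where "N = distr L.lim borel R"
  show ?thesis
  proof (rule that)
    show "prob_space N" unfolding N_def by (intro prob_space.prob_space_distr L.P.prob_space_axioms R)
    show "sets N = sets borel" by (simp add: N_def)
    fix w :: "nat list"
    let ?k = "length w" and ?J = "{..<length w}"
    define Y where "Y = {f \<in> space (\<Pi>\<^sub>M j\<in>?J. borel). \<forall>i\<in>?J. nat \<lfloor>f i :: real\<rfloor> = w ! i}"
    have Y: "Y \<in> sets (\<Pi>\<^sub>M j\<in>?J. borel)" unfolding Y_def by measurable
    have "measure N (cylinder UNIV w) = measure L.lim (R -` cylinder UNIV w \<inter> space L.lim)"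
      unfolding N_def by (intro measure_distr R open_cylinder_sets)
    also have "R -` cylinder UNIV w \<inter> space L.lim = L.emb UNIV ?J Y"
      by (auto simp: prod_emb_def Y_def R_def cylinder_def space_PiM L.space_lim)
    also have "measure L.lim \<dots> = measure (P ?J) Y"
      by (intro L.measure_lim_emb Y) auto
    also have "\<dots> = measure (distr (measure_pmf (Q (?k + bound ?J))) (\<Pi>\<^sub>M j\<in>?J. borel) (val ?J)) Y"
      using P_eq[of ?J "?k + bound ?J"] by simp
    also have "\<dots> = measure (measure_pmf (Q (?k + bound ?J))) (val ?J -` Y)"
      using measure_distr[OF val_meas Y] by simp
    also have "val ?J -` Y = take ?k -` {v. \<forall>i<?k. v ! i = w ! i}"
      by (auto simp: Y_def val_def space_PiM)
    also have "measure (measure_pmf (Q (?k + bound ?J))) \<dots> = measure (measure_pmf (Q ?k)) {v. \<forall>i<?k. v ! i = w ! i}"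
      by (subst take_Q[of ?k "bound ?J", symmetric]) simp
    also have "\<dots> = measure (measure_pmf (Q ?k)) {w}"
      by (intro measure_pmf.finite_measure_eq_AE) (auto simp: AE_measure_pmf_iff dest!: length_Q intro: nth_equalityI)
    also have "\<dots> = p w" by (simp add: measure_pmf_single pmf_Q)
    finally show "measure N (cylinder UNIV w) = p w" .
  qed
qed

section \<open>Compactness of the invariant probabilities up to escaping mass\<close>

lemma restrict_invariant:
  assumes X: "shift_space X" and N: "prob_space N" "sets N = sets borel"
    and inv: "distr N borel shift = N" and full: "emeasure N X = 1"
  shows "restrict_space N X \<in> invariant_probs X"
proof -
  interpret prob_space N by fact
  have spN: "space N = UNIV" using N(2) by (auto dest: sets_eq_imp_space_eq)
  have Xb: "X \<in> sets borel" using X by (simp add: shift_space_def)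
  have sets: "sets (restrict_space N X) = sets (restrict_space borel X)"
    by (rule sets_restrict_space_cong) (rule N(2))
  have X_shift: "x \<in> X \<Longrightarrow> shift x \<in> X" for x using X by (auto simp: shift_space_def)
  have shiftN: "shift \<in> measurable N borel"
    using shift_measurable by (simp add: measurable_cong_sets[OF N(2) refl])
  have sm: "shift \<in> measurable (restrict_space N X) (restrict_space borel X)"
    by (intro measurable_restrict_space2 measurable_restrict_space1 shiftN)
       (auto simp: space_restrict_space X_shift)
  have AE_X: "AE x in N. x \<in> X"
    using full Xb N(2) by (intro AE_prob_1) (simp add: emeasure_eq_measure)
  have "distr (restrict_space N X) (restrict_space borel X) shift = restrict_space N X"
  proof (rule measure_eqI)
    fix E assume "E \<in> sets (distr (restrict_space N X) (restrict_space borel X) shift)"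
    then have E': "E \<in> sets (restrict_space borel X)" by simp
    then have E: "E \<subseteq> X" "E \<in> sets borel"
      using Xb by (auto simp: sets_restrict_space)
    have "emeasure (distr (restrict_space N X) (restrict_space borel X) shift) E =
        emeasure (restrict_space N X) (shift -` E \<inter> X)"
      using emeasure_distr[OF sm E'] by (simp add: space_restrict_space spN)
    also have "\<dots> = emeasure N (shift -` E \<inter> X)"
      using Xb N(2) by (intro emeasure_restrict_space) (auto simp: spN)
    also have "\<dots> = emeasure N (shift -` E)"
      using AE_X measurable_sets[OF shiftN E(2)] Xb N(2) by (intro emeasure_eq_AE) (auto simp: spN)
    also have "\<dots> = emeasure (distr N borel shift) E"
      using emeasure_distr[OF shiftN E(2)] by (simp add: spN)
    also have "\<dots> = emeasure (restrict_space N X) E"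
      unfolding inv using Xb N(2) E by (intro emeasure_restrict_space[symmetric]) (auto simp: spN)
    finally show "emeasure (distr (restrict_space N X) (restrict_space borel X) shift) E =
        emeasure (restrict_space N X) E" .
  qed (simp add: sets)
  then show ?thesis
    using prob_space_restrict_space[of X] Xb N(2) full sets
    by (auto simp: invariant_probs_def borel_probs_def)
qed

text \<open>
  A compactness theorem for convergence on cylinders: every limit is \<open>t * \<nu>\<close>, with \<open>1 - t\<close> the mass
  lost at infinity and \<open>\<nu>\<close> still an invariant probability.
\<close>

lemma invariant_probs_cylinder_compact:
  assumes X: "shift_space X" and F: "finite_cyclic_predecessor X"
    and \<mu>: "\<And>n. \<mu> n \<in> invariant_probs X"
  obtains r \<nu> t where "strict_mono (r :: nat \<Rightarrow> nat)" "\<nu> \<in> invariant_probs X" "0 \<le> t" "t \<le> 1"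
    "\<And>w. w \<noteq> [] \<Longrightarrow>
      (\<lambda>n. measure (\<mu> (r n)) (cylinder X w)) \<longlonglongrightarrow> t * measure \<nu> (cylinder X w)"
proof -
  obtain r m where r: "strict_mono (r :: nat \<Rightarrow> nat)"
    and m: "\<And>w. (\<lambda>n. measure (\<mu> (r n)) (cylinder X w)) \<longlonglongrightarrow> m w"
    and right: "\<And>w. w \<noteq> [] \<Longrightarrow> (\<lambda>b. m (w @ [b])) sums m w"
    and left: "\<And>w. w \<noteq> [] \<Longrightarrow> (\<lambda>b. m (b # w)) sums m w"
    using cylinder_limit[where \<mu> = \<mu>, OF X F \<mu>] by blast
  have nonneg: "0 \<le> m w" for w
    by (rule LIMSEQ_le_const[OF m]) simp
  have le1: "(\<Sum>i<B. m [i]) \<le> 1" for B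
  proof (rule LIMSEQ_le_const2)
    show "(\<lambda>n. \<Sum>i<B. measure (\<mu> (r n)) (cylinder X [i])) \<longlonglongrightarrow> (\<Sum>i<B. m [i])"
      by (intro tendsto_sum m)
    have "(\<Sum>i<B. measure (\<mu> n) (cylinder X [i])) \<le> 1" for n
      using prob_space.prob_le_1[OF invariant_probsD(1)[OF \<mu>]]
      by (simp add: measure_letters_less[OF \<mu>, symmetric])
    then show "\<exists>N. \<forall>n\<ge>N. (\<Sum>i<B. measure (\<mu> (r n)) (cylinder X [i])) \<le> 1" by blast
  qed
  have summ: "summable (\<lambda>i. m [i])"
    by (rule summableI_nonneg_bounded[OF nonneg le1])
  define t where "t = (\<Sum>i. m [i])"
  have t: "0 \<le> t" "t \<le> 1"
    unfolding t_def using summ nonneg le1 by (auto intro: suminf_nonneg suminf_le_const)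
  have letter_sums: "(\<lambda>i. m [i]) sums t" using summ by (simp add: t_def summable_sums)
  show ?thesis
  proof (cases "t = 0")
    case True
    \<comment> \<open>All mass escapes: every cylinder measure tends to \<open>0\<close>, and any invariant probability serves as \<open>\<nu>\<close>.\<close>
    have "m w = 0" if "w \<noteq> []" for w
      using that
    proof (induction w rule: rev_induct)
      case (snoc b w)
      have "m (w @ [b]) \<le> 0"
      proof (cases "w = []")
        case True
        then show ?thesis
          using sum_le_suminf[OF summ, of "{b}"] nonneg \<open>t = 0\<close> by (simp add: t_def)
      next
        case False
        then show ?thesis
          using sum_le_suminf[OF sums_summable[OF right], of w "{b}"] nonneg
            sums_unique[OF right, of w] snoc by simp
      qed
      then show ?case using nonneg[of "w @ [b]"] by simp
    qed simp
    then have "(\<lambda>n. measure (\<mu> (r n)) (cylinder X w)) \<longlonglongrightarrow> t * measure (\<mu> 0) (cylinder X w)"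
      if "w \<noteq> []" for w
      using m[of w] that True by simp
    then show ?thesis using that r \<mu> t by blast
  next
    case False
    then have pos: "0 < t" using t by simp
    \<comment> \<open>The value at the empty word restores right consistency there.\<close>
    define p where "p w = (if w = [] then 1 else m w / t)" for w
    have p_sums: "(\<lambda>b. p (w @ [b])) sums p w" for w
      using sums_divide[OF letter_sums, of t] sums_divide[OF right, of w t] pos
      by (cases "w = []") (simp_all add: p_def)
    obtain N where N: "prob_space N" "sets N = sets (borel :: (nat \<Rightarrow> nat) measure)"
      and Np: "\<And>w. measure N (cylinder UNIV w) = p w"
      by (rule measure_with_cylinder_probabilities[of p])
        (use p_sums nonneg pos in \<open>auto simp: p_def\<close>)
    interpret N: prob_space N by fact
    have spN: "space N = UNIV" using N(2) by (auto dest: sets_eq_imp_space_eq)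
    have shiftN: "shift \<in> measurable N borel"
      using shift_measurable by (simp add: measurable_cong_sets[OF N(2) refl])
    have C: "cylinder UNIV w \<in> sets N" for w using N(2) open_cylinder_sets by simp

    have "distr N borel shift = N"
    proof (rule borel_prob_eqI)
      show "prob_space (distr N borel shift)" by (rule N.prob_space_distr[OF shiftN])
      fix w :: "nat list" assume w: "w \<noteq> []"
      have "measure (distr N borel shift) (cylinder UNIV w) = measure N (shift -` cylinder UNIV w)"
        using measure_distr[OF shiftN open_cylinder_sets] by (simp add: spN)
      also have "shift -` cylinder UNIV w = (\<Union>b. cylinder UNIV (b # w))"
        by (auto simp: cylinder_def shift_def less_Suc_eq_0_disj)
      also have "measure N \<dots> = (\<Sum>b. measure N (cylinder UNIV (b # w)))"
      proof (intro sums_unique N.finite_measure_UNION)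
        show "disjoint_family (\<lambda>b. cylinder UNIV (b # w))"
          by (auto simp: disjoint_family_on_def cylinder_def)
      qed (use C in auto)
      also have "\<dots> = p w"
        using sums_divide[OF left[OF w], of t] w by (simp add: Np p_def sums_iff)
      finally show "measure (distr N borel shift) (cylinder UNIV w) = measure N (cylinder UNIV w)"
        by (simp add: Np)
    qed (use N in auto)

    moreover have "emeasure N X = 1"
    proof -
      \<comment> \<open>As \<open>X\<close> is closed, its complement is a countable union of cylinders that miss \<open>X\<close>.\<close>
      have "closed X" using X by (simp add: shift_space_def)
      define W where "W = {w. w \<noteq> [] \<and> cylinder X w = {}}"
      have "- X \<subseteq> (\<Union>w\<in>W. cylinder UNIV w)"
      proof
        fix x assume "x \<in> - X"
        then obtain k where k: "cylinder UNIV (map x [0..<k]) \<subseteq> - X"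
          using cylinder_basis[of "- X" x] \<open>closed X\<close> by (auto simp: open_closed)
        have "cylinder UNIV (map x [0..<Suc k]) \<subseteq> cylinder UNIV (map x [0..<k])"
          by (auto simp: cylinder_def nth_append)
        then have "map x [0..<Suc k] \<in> W"
          using k by (auto simp: W_def cylinder_eq_Int[of X])
        then show "x \<in> (\<Union>w\<in>W. cylinder UNIV w)"
          using in_own_cylinder[of x UNIV "Suc k"] by blast
      qed
      moreover have "(\<Union>w\<in>W. cylinder UNIV w) \<in> null_sets N"
      proof (intro null_sets_UN')
        fix w assume w: "w \<in> W"
        then have "m w = 0" using m[of w] by (simp add: W_def LIMSEQ_const_iff)
        then show "cylinder UNIV w \<in> null_sets N"
          using w Np[of w] C[of w] by (simp add: null_sets_def N.emeasure_eq_measure W_def p_def)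
      qed (rule countableI_type)
      ultimately have "AE x in N. x \<in> X" by (auto intro: AE_I')
      then show ?thesis
        using \<open>closed X\<close> N(2) by (intro N.emeasure_eq_1_AE) auto
    qed
    ultimately have inv: "restrict_space N X \<in> invariant_probs X"
      by (intro restrict_invariant X N)
    have "(\<lambda>n. measure (\<mu> (r n)) (cylinder X w)) \<longlonglongrightarrow> t * measure (restrict_space N X) (cylinder X w)"
      if w: "w \<noteq> []" for w
    proof -
      have Xb: "X \<in> sets N" using X N(2) by (simp add: shift_space_def)
      have "AE x in N. x \<in> X"
        using \<open>emeasure N X = 1\<close> Xb by (intro N.AE_prob_1) (simp add: N.emeasure_eq_measure)
      then have "measure N (cylinder X w) = measure N (cylinder UNIV w)"
        using C[of w] Xb unfolding cylinder_eq_Int[of X]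
        by (intro N.finite_measure_eq_AE) auto
      moreover have "measure (restrict_space N X) (cylinder X w) = measure N (cylinder X w)"
        using Xb by (intro measure_restrict_space) (auto simp: spN cylinder_def)
      ultimately show ?thesis using m[of w] w pos by (simp add: Np p_def)
    qed
    then show ?thesis using that r inv t by blast
  qed
qed

section \<open>Semicontinuity of the integral\<close>

lemma nn_integral_cylinder_function:
  assumes \<mu>: "\<mu> \<in> invariant_probs X"
  shows "(\<integral>\<^sup>+x. h (map x [0..<k]) \<partial>\<mu>) =
    (\<integral>\<^sup>+w. (if length w = k then h w else 0) * emeasure \<mu> (cylinder X w) \<partial>count_space UNIV)"
proof -
  define h' where "h' w = (if length w = k then h w else (0::ennreal))" for w
  note [measurable] = cylinder_in_sets[OF \<mu>]
  have "h (map x [0..<k]) = (\<integral>\<^sup>+w. h' w * indicator (cylinder X w) x \<partial>count_space UNIV)"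
    if "x \<in> space \<mu>" for x
  proof -
    have x: "x \<in> X" using that invariant_probsD(3)[OF \<mu>] by simp
    have "h' w * indicator (cylinder X w) x = h (map x [0..<k]) * indicator {map x [0..<k]} w" for w
    proof (cases "length w = k")
      case True
      then have "x \<in> cylinder X w \<longleftrightarrow> w = map x [0..<k]"
        using x by (auto simp: in_cylinder_iff)
      then show ?thesis using True by (auto simp: h'_def indicator_def)
    next
      case False
      then have "w \<noteq> map x [0..<k]" by auto
      then show ?thesis using False by (simp add: h'_def)
    qed
    then show ?thesis by (simp add: nn_integral_cmult_indicator)
  qed
  then have "(\<integral>\<^sup>+x. h (map x [0..<k]) \<partial>\<mu>) =
      (\<integral>\<^sup>+x. \<integral>\<^sup>+w. h' w * indicator (cylinder X w) x \<partial>count_space UNIV \<partial>\<mu>)"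
    by (rule nn_integral_cong)
  also have "\<dots> = (\<integral>\<^sup>+w. \<integral>\<^sup>+x. h' w * indicator (cylinder X w) x \<partial>\<mu> \<partial>count_space UNIV)"
    by (rule nn_integral_count_space_nn_integral) auto
  also have "\<dots> = (\<integral>\<^sup>+w. h' w * emeasure \<mu> (cylinder X w) \<partial>count_space UNIV)"
    by (simp add: nn_integral_cmult_indicator)
  finally show ?thesis by (simp add: h'_def)
qed

text \<open>
  A nonnegative lower semicontinuous function is the increasing limit of its infima over cylinders.
  For a function of finitely many letters the integral is a series over words, and Fatou's lemma for
  series applies to the convergence on cylinders; monotone convergence does the rest.
\<close>

lemma lsc_integral_le_liminf:
  fixes g :: "(nat \<Rightarrow> nat) \<Rightarrow> real"
  assumes \<mu>: "\<And>n. \<mu> n \<in> invariant_probs X" and \<nu>: "\<nu> \<in> invariant_probs X" and "0 \<le> t"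
    and lim: "\<And>w. w \<noteq> [] \<Longrightarrow>
      (\<lambda>n. measure (\<mu> n) (cylinder X w)) \<longlonglongrightarrow> t * measure \<nu> (cylinder X w)"
    and lsc: "\<And>x c. x \<in> X \<Longrightarrow> c < g x \<Longrightarrow> \<exists>k. \<forall>y\<in>cylinder X (map x [0..<k]). c < g y"
  shows "ennreal t * (\<integral>\<^sup>+x. ennreal (g x) \<partial>\<nu>) \<le> liminf (\<lambda>n. \<integral>\<^sup>+x. ennreal (g x) \<partial>\<mu> n)"
proof -
  \<comment> \<open>\<open>G k\<close> depends on \<open>k + 1\<close> letters; the empty word, on which convergence may fail, is avoided.\<close>
  define h where "h w = (INF y\<in>cylinder X w. ennreal (g y))" for w
  define G where "G k x = h (map x [0..<Suc k])" for k x
  have G_le: "G k x \<le> ennreal (g x)" if "x \<in> X" for k x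
    unfolding G_def h_def using in_own_cylinder[OF that] by (rule INF_lower)
  have cyl_mono: "cylinder X (map x [0..<l]) \<subseteq> cylinder X (map x [0..<k])" if "k \<le> l" for x k l
    using that by (auto simp: cylinder_def)
  have G_mono: "G k x \<le> G l x" if "k \<le> l" for k l x
    unfolding G_def h_def using cyl_mono[of "Suc k" "Suc l" x] that by (intro INF_superset_mono) auto
  have G_sup: "(SUP k. G k x) = ennreal (g x)" if x: "x \<in> X" for x
  proof (rule antisym)
    show "(SUP k. G k x) \<le> ennreal (g x)" by (intro SUP_least G_le x)
    show "ennreal (g x) \<le> (SUP k. G k x)"
    proof (rule dense_le)
      fix d assume d: "d < ennreal (g x)"
      then obtain c where c: "d = ennreal c" "0 \<le> c" by (cases d) auto
      then have "c < g x" using d by (simp add: ennreal_less_iff)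
      then obtain k where "\<forall>y\<in>cylinder X (map x [0..<k]). c < g y" using lsc[OF x] by blast
      then have "\<forall>y\<in>cylinder X (map x [0..<Suc k]). c < g y"
        using cyl_mono[of k "Suc k" x] by (auto simp del: upt_Suc)
      then have "d \<le> G k x"
        unfolding G_def h_def c by (intro INF_greatest) (auto simp del: upt_Suc intro!: ennreal_leI)
      then show "d \<le> (SUP k. G k x)" by (rule order_trans) (auto intro: SUP_upper)
    qed
  qed
  have step: "ennreal t * (\<integral>\<^sup>+x. G k x \<partial>\<nu>) \<le> liminf (\<lambda>n. \<integral>\<^sup>+x. ennreal (g x) \<partial>\<mu> n)" for k
  proof -
    define h' where "h' w = (if length w = Suc k then h w else 0)" for w
    have term_lim: "(\<lambda>n. h' w * emeasure (\<mu> n) (cylinder X w)) \<longlonglongrightarrow>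
        ennreal t * (h' w * emeasure \<nu> (cylinder X w))" for w
    \<comment> \<open>On an empty cylinder the infimum \<open>h w\<close> is \<open>\<top>\<close>, but all measures vanish there.\<close>
    proof (cases "cylinder X w = {} \<or> length w \<noteq> Suc k")
      case True
      then show ?thesis by (auto simp: h'_def)
    next
      case False
      then have w: "w \<noteq> []" and "\<exists>y. y \<in> cylinder X w" by auto
      then obtain y where y: "y \<in> cylinder X w" by blast
      have "h w \<le> ennreal (g y)" unfolding h_def using y by (rule INF_lower)
      then have fin: "h' w < \<top>" using False by (auto simp: h'_def le_less_trans)
      have em: "emeasure \<rho> E = ennreal (measure \<rho> E)" if "\<rho> \<in> invariant_probs X" for \<rho> E
        using invariant_probsD(1)[OF that] finite_measure.emeasure_eq_measure
        by (auto simp: prob_space_def)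
      have "(\<lambda>n. ennreal (measure (\<mu> n) (cylinder X w))) \<longlonglongrightarrow> ennreal (t * measure \<nu> (cylinder X w))"
        by (intro tendsto_ennrealI lim w)
      then have "(\<lambda>n. h' w * ennreal (measure (\<mu> n) (cylinder X w))) \<longlonglongrightarrow>
          h' w * ennreal (t * measure \<nu> (cylinder X w))"
        by (rule ennreal_tendsto_cmult[OF fin])
      then show ?thesis
        using \<open>0 \<le> t\<close> by (simp add: em[OF \<mu>] em[OF \<nu>] ennreal_mult mult_ac)
    qed
    have "ennreal t * (\<integral>\<^sup>+x. G k x \<partial>\<nu>) =
        (\<integral>\<^sup>+w. ennreal t * (h' w * emeasure \<nu> (cylinder X w)) \<partial>count_space UNIV)"
      unfolding G_def nn_integral_cylinder_function[OF \<nu>] h'_def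
      by (intro nn_integral_cmult[symmetric]) simp
    also have "\<dots> = (\<integral>\<^sup>+w. liminf (\<lambda>n. h' w * emeasure (\<mu> n) (cylinder X w)) \<partial>count_space UNIV)"
      using lim_imp_Liminf[OF sequentially_bot term_lim] by simp
    also have "\<dots> \<le> liminf (\<lambda>n. \<integral>\<^sup>+w. h' w * emeasure (\<mu> n) (cylinder X w) \<partial>count_space UNIV)"
      by (intro nn_integral_liminf) simp
    also have "\<dots> = liminf (\<lambda>n. \<integral>\<^sup>+x. G k x \<partial>\<mu> n)"
      unfolding G_def nn_integral_cylinder_function[OF \<mu>] h'_def ..
    also have "\<dots> \<le> liminf (\<lambda>n. \<integral>\<^sup>+x. ennreal (g x) \<partial>\<mu> n)"
      by (intro Liminf_mono always_eventually allI nn_integral_mono G_le)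
         (simp add: invariant_probsD(3)[OF \<mu>])
    finally show ?thesis .
  qed
  have G_meas: "G k \<in> borel_measurable \<nu>" for k
  proof -
    have "(\<lambda>x. map x [0..<Suc k]) \<in> measurable \<nu> (count_space UNIV)"
    proof (rule measurable_count_space_eq_countable[THEN iffD2])
      show "(\<lambda>x. map x [0..<Suc k]) \<in> space \<nu> \<rightarrow> UNIV \<and>
          (\<forall>w\<in>UNIV. (\<lambda>x. map x [0..<Suc k]) -` {w} \<inter> space \<nu> \<in> sets \<nu>)"
      proof (intro conjI ballI)
        fix w :: "nat list"
        have "(\<lambda>x. map x [0..<Suc k]) -` {w} \<inter> space \<nu> =
            (if length w = Suc k then cylinder X w else {})"
          unfolding invariant_probsD(3)[OF \<nu>]
          by (auto simp: in_cylinder_iff simp del: upt_Suc)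
        moreover have "cylinder X w \<in> sets \<nu>" by (rule cylinder_in_sets[OF \<nu>])
        ultimately show "(\<lambda>x. map x [0..<Suc k]) -` {w} \<inter> space \<nu> \<in> sets \<nu>" by simp
      qed simp
    qed (rule countableI_type)
    then show ?thesis unfolding G_def by (rule measurable_compose) simp
  qed
  have "(\<integral>\<^sup>+x. ennreal (g x) \<partial>\<nu>) = (\<integral>\<^sup>+x. (SUP k. G k x) \<partial>\<nu>)"
    by (intro nn_integral_cong) (simp add: G_sup invariant_probsD(3)[OF \<nu>])
  also have "\<dots> = (SUP k. \<integral>\<^sup>+x. G k x \<partial>\<nu>)"
    by (intro nn_integral_monotone_convergence_SUP G_meas) (auto simp: incseq_def le_fun_def G_mono)
  finally have "ennreal t * (\<integral>\<^sup>+x. ennreal (g x) \<partial>\<nu>) = (SUP k. ennreal t * (\<integral>\<^sup>+x. G k x \<partial>\<nu>))"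
    by (simp add: SUP_mult_left_ennreal)
  also have "\<dots> \<le> liminf (\<lambda>n. \<integral>\<^sup>+x. ennreal (g x) \<partial>\<mu> n)" by (intro SUP_least step)
  finally show ?thesis .
qed

text \<open>
  Subtracting \<open>A\<close> from a bounded function above it turns the extended integral, which may be
  \<open>-\<infinity>\<close>, into the integral of a nonnegative function.
\<close>

lemma ext_integral_eq:
  assumes M: "prob_space M" and A [measurable]: "A \<in> borel_measurable M"
    and H [measurable]: "H \<in> borel_measurable M"
    and bound: "\<And>x. x \<in> space M \<Longrightarrow> \<bar>H x\<bar> \<le> K" and le: "\<And>x. x \<in> space M \<Longrightarrow> A x \<le> H x"
  shows "ext_integral M A = ereal (integral\<^sup>L M H) - enn2ereal (\<integral>\<^sup>+x. ennreal (H x - A x) \<partial>M)"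
proof -
  interpret prob_space M by fact
  have intH: "integrable M H"
    using bound by (intro integrable_const_bound[of _ K]) auto
  define a a' h h' g where "a = (\<integral>\<^sup>+x. ennreal (A x) \<partial>M)" and "a' = (\<integral>\<^sup>+x. ennreal (- A x) \<partial>M)"
    and "h = (\<integral>\<^sup>+x. ennreal (H x) \<partial>M)" and "h' = (\<integral>\<^sup>+x. ennreal (- H x) \<partial>M)"
    and "g = (\<integral>\<^sup>+x. ennreal (H x - A x) \<partial>M)"
  have pointwise: "ennreal (A x) + ennreal (H x - A x) + ennreal (- H x) = ennreal (- A x) + ennreal (H x)"
    if "x \<in> space M" for x
    using le[OF that]
    by (cases "0 \<le> A x"; cases "0 \<le> H x") (auto simp: ennreal_neg simp flip: ennreal_plus)
  have "a + g + h' = (\<integral>\<^sup>+x. ennreal (A x) + ennreal (H x - A x) + ennreal (- H x) \<partial>M)"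
    by (simp add: a_def g_def h'_def nn_integral_add)
  also have "\<dots> = (\<integral>\<^sup>+x. ennreal (- A x) + ennreal (H x) \<partial>M)"
    by (intro nn_integral_cong pointwise)
  also have "\<dots> = a' + h"
    by (simp add: a'_def h_def nn_integral_add)
  finally have sum: "a + g + h' = a' + h" .
  have fin: "h < \<top>" "h' < \<top>"
    using intH by (auto simp: real_integrable_def h_def h'_def less_top)
  have "a \<le> h"
    unfolding a_def h_def by (intro nn_integral_mono ennreal_leI le)
  then have fina: "a < \<top>" using fin by simp
  have intH_eq: "integral\<^sup>L M H = enn2real h - enn2real h'"
    unfolding h_def h'_def by (rule real_lebesgue_integral_def[OF intH])
  obtain ra rh rh' where r: "a = ennreal ra" "0 \<le> ra" "h = ennreal rh" "0 \<le> rh"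
      "h' = ennreal rh'" "0 \<le> rh'"
    using fin fina by (metis ennreal_cases less_irrefl infinity_ennreal_def)
  have "enn2ereal a - enn2ereal a' = ereal (enn2real h - enn2real h') - enn2ereal g"
  proof (cases a')
    case (real ra')
    then have "a + g + h' < \<top>" unfolding sum using fin by simp
    then have "g < \<top>" by simp
    then obtain rg where rg: "g = ennreal rg" "0 \<le> rg" by (metis ennreal_cases less_irrefl infinity_ennreal_def)
    have "ennreal (ra + rg + rh') = ennreal (ra' + rh)"
      using sum r rg real by (simp add: ennreal_plus)
    then have "ra + rg + rh' = ra' + rh"
      using r rg real by (subst (asm) ennreal_inj) auto
    then show ?thesis using r rg real by simp
  next
    case top
    then have "g = \<top>" using sum fin fina by (auto simp: ennreal_add_eq_top less_top)
    then show ?thesis using top r by simp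
  qed
  then show ?thesis
    unfolding ext_integral_def intH_eq a_def a'_def g_def .
qed

section \<open>Existence and localisation of maximizing probabilities\<close>

theorem mainTheorem1:
  fixes X :: "(nat \<Rightarrow> nat) set" and A :: "(nat \<Rightarrow> nat) \<Rightarrow> real"
  assumes "shift_space X"
    and "finite_cyclic_predecessor X"
    and "dense_periodic_probs X"
    and "potential X A"
    and "upper_semicontinuous_on X A"
    and "limsup (\<lambda>i. SUP x\<in>cylinder X [i]. ereal (A x)) < max_const X A"
  shows "(\<exists>\<mu>. \<mu> \<in> maximizing_probs X A) \<and>
    ((SUP x\<in>X. ereal (A x)) \<le> max_const X A \<longrightarrow>
      (\<exists>Y. finite_alphabet_subshift X Y \<and> (\<forall>\<mu>\<in>maximizing_probs X A. supp X \<mu> \<subseteq> Y)))"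
proof -
  note X = assms(1) and F = assms(2)
  obtain c where c: "limsup (\<lambda>i. SUP x\<in>cylinder X [i]. ereal (A x)) < ereal c" "ereal c < max_const X A"
    using ereal_dense2[OF assms(6)] by blast
  obtain I where I: "\<And>i. I \<le> i \<Longrightarrow> (SUP x\<in>cylinder X [i]. ereal (A x)) < ereal c"
    using Limsup_lessD[OF c(1)] by (auto simp: eventually_sequentially)
  have A_far: "A x < c" if "x \<in> X" "I \<le> x 0" for x
  proof -
    have "ereal (A x) \<le> (SUP x\<in>cylinder X [x 0]. ereal (A x))"
      using that by (intro SUP_upper) (simp add: cylinder_def)
    also have "\<dots> < ereal c" using I[OF that(2)] .
    finally show ?thesis by simp
  qed
  obtain K where K: "\<And>x. x \<in> X \<Longrightarrow> A x \<le> K"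
    using assms(4) by (auto simp: potential_def bdd_above_def)
  \<comment> \<open>\<open>H\<close> dominates \<open>A\<close>, is locally constant, and equals \<open>c\<close> far out, where mass may be lost.\<close>
  define S where "S = max 0 (K - c)"
  have "0 \<le> S" by (simp add: S_def)
  define H where "H x = (if x 0 < I then S else 0) + c" for x :: "nat \<Rightarrow> nat"
  have A_le_H: "A x \<le> H x" if "x \<in> X" for x
    using K[OF that] A_far[OF that] by (auto simp: H_def S_def not_less less_imp_le)

  have A_meas: "A \<in> borel_measurable \<mu>" if "\<mu> \<in> invariant_probs X" for \<mu>
    using assms(4) measurable_cong_sets[OF invariant_probsD(2)[OF that] refl]
    by (auto simp: potential_def)
  have near: "{x \<in> X. x 0 < I} \<in> sets \<mu>" if "\<mu> \<in> invariant_probs X" for \<mu>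
    by (intro events_in_sets[OF that]) measurable
  have H_meas: "H \<in> borel_measurable \<mu>" if "\<mu> \<in> invariant_probs X" for \<mu>
    unfolding H_def using near[OF that]
    by (intro borel_measurable_add borel_measurable_const measurable_If)
       (simp_all add: invariant_probsD(3)[OF that])
  have H_int: "integral\<^sup>L \<mu> H = S * measure \<mu> {x \<in> X. x 0 < I} + c" if \<mu>: "\<mu> \<in> invariant_probs X" for \<mu>
  proof -
    interpret prob_space \<mu> using invariant_probsD(1)[OF \<mu>] .
    have "integral\<^sup>L \<mu> H = (\<integral>x. S * indicator {x \<in> X. x 0 < I} x + c \<partial>\<mu>)"
      by (intro Bochner_Integration.integral_cong) (auto simp: H_def invariant_probsD(3)[OF \<mu>])
    also have "\<dots> = S * measure \<mu> {x \<in> X. x 0 < I} + c"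
    proof -
      have "integrable \<mu> (indicat_real {x \<in> X. x 0 < I})"
        using near[OF \<mu>] by (intro integrable_real_indicator) (auto simp: emeasure_eq_measure)
      moreover have "{x \<in> X. x 0 < I} \<inter> space \<mu> = {x \<in> X. x 0 < I}"
        by (auto simp: invariant_probsD(3)[OF \<mu>])
      ultimately show ?thesis by (simp add: prob_space)
    qed
    finally show ?thesis .
  qed
  define G where "G \<mu> = (\<integral>\<^sup>+x. ennreal (H x - A x) \<partial>\<mu>)" for \<mu>
  have ext: "ext_integral \<mu> A = ereal (S * measure \<mu> {x \<in> X. x 0 < I} + c) - enn2ereal (G \<mu>)"
    if \<mu>: "\<mu> \<in> invariant_probs X" for \<mu>
    unfolding G_def H_int[OF \<mu>, symmetric]
    by (rule ext_integral_eq[where K = "\<bar>S\<bar> + \<bar>c\<bar>", OF invariant_probsD(1)[OF \<mu>] A_meas[OF \<mu>] H_meas[OF \<mu>]])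
       (auto simp: A_le_H invariant_probsD(3)[OF \<mu>], auto simp: H_def)

  have nonempty: "invariant_probs X \<noteq> {}"
    using c(2) by (auto simp: max_const_def bot_ereal_def)
  have "max_const X A \<le> ereal (S + c)"
    unfolding max_const_def
  proof (rule SUP_least)
    fix \<mu> assume \<mu>: "\<mu> \<in> invariant_probs X"
    have "S * measure \<mu> {x \<in> X. x 0 < I} \<le> S"
      using \<open>0 \<le> S\<close> prob_space.prob_le_1[OF invariant_probsD(1)[OF \<mu>]] by (simp add: mult_left_le)
    then have "ereal (S * measure \<mu> {x \<in> X. x 0 < I} + c) - enn2ereal (G \<mu>) \<le> ereal (S + c) - 0"
      by (intro ereal_minus_mono) auto
    then show "ext_integral \<mu> A \<le> ereal (S + c)" by (simp add: ext[OF \<mu>])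
  qed
  then obtain b where b: "max_const X A = ereal b"
    using c(2) by (cases "max_const X A") auto
  have "c < b" using c(2) b by simp

  obtain f :: "nat \<Rightarrow> ereal" where f: "incseq f" "range f \<subseteq> (\<lambda>\<mu>. ext_integral \<mu> A) ` invariant_probs X"
      "max_const X A = (SUP n. f n)"
    using Sup_countable_SUP[of "(\<lambda>\<mu>. ext_integral \<mu> A) ` invariant_probs X"] nonempty
    by (auto simp: max_const_def)
  have "\<forall>n. \<exists>\<mu>. \<mu> \<in> invariant_probs X \<and> f n = ext_integral \<mu> A" using f(2) by blast
  from choice[OF this] obtain \<mu> where \<mu>: "\<And>n. \<mu> n \<in> invariant_probs X" "\<And>n. f n = ext_integral (\<mu> n) A"
    by blast
  have f_lim: "f \<longlonglongrightarrow> ereal b" using LIMSEQ_SUP[OF f(1)] f(3) b by simp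
  obtain r \<nu> t where r: "strict_mono (r :: nat \<Rightarrow> nat)" and \<nu>: "\<nu> \<in> invariant_probs X"
    and t: "0 \<le> t" "t \<le> 1"
    and lim: "\<And>w. w \<noteq> [] \<Longrightarrow>
      (\<lambda>n. measure (\<mu> (r n)) (cylinder X w)) \<longlonglongrightarrow> t * measure \<nu> (cylinder X w)"
    using invariant_probs_cylinder_compact[where \<mu> = \<mu>, OF X F \<mu>(1)] by blast

  \<comment> \<open>\<open>\<integral>H\<close> depends on finitely many letters and converges; \<open>L\<close> is the limit of \<open>\<integral>(H - A)\<close>.\<close>
  define q where "q = measure \<nu> {x \<in> X. x 0 < I}"
  have q_lim: "(\<lambda>n. measure (\<mu> (r n)) {x \<in> X. x 0 < I}) \<longlonglongrightarrow> t * q"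
    unfolding q_def measure_letters_less[OF \<mu>(1)] measure_letters_less[OF \<nu>] sum_distrib_left
    by (intro tendsto_sum lim) simp
  define L where "L = S * (t * q) + c - b"
  have G_eq: "enn2ereal (G (\<mu> (r n))) = ereal (S * measure (\<mu> (r n)) {x \<in> X. x 0 < I} + c) - f (r n)" for n
    unfolding \<mu>(2) ext[OF \<mu>(1)] by (cases "enn2ereal (G (\<mu> (r n)))") auto
  have "(\<lambda>n. enn2ereal (G (\<mu> (r n)))) \<longlonglongrightarrow> ereal (S * (t * q) + c) - ereal b"
    unfolding G_eq
    using LIMSEQ_subseq_LIMSEQ[OF f_lim r]
    by (intro tendsto_diff_ereal tendsto_intros q_lim) (auto simp: comp_def)
  then have G_lim: "(\<lambda>n. enn2ereal (G (\<mu> (r n)))) \<longlonglongrightarrow> ereal L"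
    by (simp add: L_def)
  have "0 \<le> ereal L"
    by (rule LIMSEQ_le_const[OF G_lim]) auto
  then have L: "0 \<le> L" by simp
  have "(\<lambda>n. e2ennreal (enn2ereal (G (\<mu> (r n))))) \<longlonglongrightarrow> e2ennreal (ereal L)"
    by (intro tendsto_e2ennrealI G_lim)
  then have "(\<lambda>n. G (\<mu> (r n))) \<longlonglongrightarrow> ennreal L"
    by simp
  then have liminf_G: "liminf (\<lambda>n. G (\<mu> (r n))) = ennreal L"
    by (intro lim_imp_Liminf) auto

  have lsc: "\<exists>k. \<forall>y\<in>cylinder X (map x [0..<k]). d < H y - A y"
    if x: "x \<in> X" and d: "d < H x - A x" for x d
  proof -
    have "openin (top_of_set X) {y \<in> X. A y < H x - d}"
      using assms(5) by (simp add: upper_semicontinuous_on_def)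
    then obtain U where U: "open U" "{y \<in> X. A y < H x - d} = X \<inter> U"
      by (auto simp: openin_open)
    have "x \<in> U" using U(2) x d by (auto simp: algebra_simps)
    then obtain k where k: "cylinder UNIV (map x [0..<k]) \<subseteq> U" using cylinder_basis[OF U(1)] by blast
    have "d < H y - A y" if y: "y \<in> cylinder X (map x [0..<Suc k])" for y
    proof -
      have y': "y \<in> X" "\<And>i. i < Suc k \<Longrightarrow> y i = x i"
        using y by (auto simp: cylinder_def simp del: upt_Suc)
      then have "y \<in> X \<inter> U" using k by (auto simp: cylinder_def)
      then have "A y < H x - d" using U(2) by blast
      moreover have "H y = H x" using y'(2)[of 0] by (simp add: H_def)
      ultimately show ?thesis by simp
    qed
    then show ?thesis by blast
  qed
  have fatou: "ennreal t * G \<nu> \<le> ennreal L"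
    unfolding liminf_G[symmetric] G_def
    by (rule lsc_integral_le_liminf[OF \<mu>(1) \<nu> t(1) lim lsc])

  \<comment> \<open>If all mass escaped, the limit \<open>L\<close> would be \<open>c - b < 0\<close>.\<close>
  have "0 < t"
  proof (rule ccontr)
    assume "\<not> 0 < t"
    then have "t = 0" using t by simp
    then show False using L \<open>c < b\<close> by (simp add: L_def)
  qed
  have "G \<nu> \<noteq> \<top>"
    using fatou \<open>0 < t\<close> by (auto simp: ennreal_mult_top top_unique)
  then obtain \<gamma> where \<gamma>: "G \<nu> = ennreal \<gamma>" "0 \<le> \<gamma>" by (cases "G \<nu>") auto
  have "t * \<gamma> \<le> L"
    using fatou \<gamma> t L by (simp add: ennreal_mult[symmetric])
  define e where "e = S * q + c - \<gamma>"
  have ext_\<nu>: "ext_integral \<nu> A = ereal e"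
    using ext[OF \<nu>] \<gamma> by (simp add: e_def q_def)
  have "ext_integral \<nu> A \<le> max_const X A"
    unfolding max_const_def by (intro SUP_upper \<nu>)
  then have "e \<le> b" by (simp add: ext_\<nu> b)
  \<comment> \<open>In other words \<open>b \<le> t * e + (1 - t) * c\<close>: the escaping mass contributes at most \<open>c\<close>.\<close>
  have te: "b - c \<le> t * (e - c)"
    using \<open>t * \<gamma> \<le> L\<close> by (simp add: e_def L_def algebra_simps)
  also have "\<dots> \<le> t * (b - c)" using \<open>e \<le> b\<close> t by (intro mult_left_mono) auto
  finally have "1 \<le> t" using \<open>c < b\<close> by simp
  then have "e = b" using te t \<open>e \<le> b\<close> by simp
  then have max_\<nu>: "\<nu> \<in> maximizing_probs X A"
    using \<nu> ext_\<nu> b by (simp add: maximizing_probs_def)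

  define Y where "Y = {x \<in> X. \<forall>n. x n < I}"
  have "finite_alphabet_subshift X Y"
  proof -
    have "closed {x :: nat \<Rightarrow> nat. x n < I}" for n
    proof -
      have "closed ((\<lambda>x :: nat \<Rightarrow> nat. x n) -` {..<I})"
        by (intro closed_vimage continuous_on_product_coordinates) (simp add: closed_def discrete_topology_class.open_discrete)
      then show ?thesis by (simp add: vimage_def)
    qed
    then have "closed (X \<inter> (\<Inter>n. {x. x n < I}))"
      using X by (intro closed_Int closed_INT) (auto simp: shift_space_def)
    moreover have "X \<inter> (\<Inter>n. {x. x n < I}) = Y" by (auto simp: Y_def)
    moreover have "shift ` Y \<subseteq> Y" using X by (auto simp: Y_def shift_space_def shift_def)
    ultimately show ?thesis
      unfolding finite_alphabet_subshift_def shift_space_def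
      by (auto simp: Y_def intro: exI[of _ "{..<I}"])
  qed
  moreover have "supp X \<mu> \<subseteq> Y"
    if le: "(SUP x\<in>X. ereal (A x)) \<le> max_const X A" and max: "\<mu> \<in> maximizing_probs X A" for \<mu>
  proof -
    have \<mu>: "\<mu> \<in> invariant_probs X" and ext_b: "ext_integral \<mu> A = ereal b"
      using max b by (auto simp: maximizing_probs_def)
    interpret prob_space \<mu> using invariant_probsD(1)[OF \<mu>] .
    note [measurable] = A_meas[OF \<mu>]
    have A_le: "A x \<le> b" if "x \<in> X" for x
      using order_trans[OF SUP_upper[OF that, of "\<lambda>x. ereal (A x)"] le] b by simp
    have "prob X = 1" using prob_space invariant_probsD(3)[OF \<mu>] by simp
    then have "ereal b = ereal b - enn2ereal (\<integral>\<^sup>+x. ennreal (b - A x) \<partial>\<mu>)"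
      using ext_integral_eq[of \<mu> A "\<lambda>_. b" "\<bar>b\<bar>"] ext_b A_le
      by (simp add: prob_space_axioms invariant_probsD(3)[OF \<mu>])
    then have "(\<integral>\<^sup>+x. ennreal (b - A x) \<partial>\<mu>) = 0"
      by (cases "\<integral>\<^sup>+x. ennreal (b - A x) \<partial>\<mu>") (auto simp: zero_ereal_def)
    then have "AE x in \<mu>. ennreal (b - A x) = 0"
      by (subst (asm) nn_integral_0_iff_AE) auto
    then have "AE x in \<mu>. \<not> I \<le> x 0"
    proof (rule AE_mp, intro AE_I2 impI)
      fix x assume "x \<in> space \<mu>" "ennreal (b - A x) = 0"
      then show "\<not> I \<le> x 0"
        using A_far[of x] \<open>c < b\<close> by (force simp: invariant_probsD(3)[OF \<mu>] ennreal_eq_0_iff)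
    qed
    moreover have far: "{x \<in> X. I \<le> x 0} \<in> sets \<mu>"
      by (intro events_in_sets[OF \<mu>]) measurable
    ultimately have "prob {x \<in> X. I \<le> x 0} = 0"
      by (subst prob_eq_0[OF far]) auto
    then have far_n: "prob {x \<in> X. I \<le> x n} = 0" for n
      using conjunct2[OF measure_tail[OF X \<mu> far, of n]] by simp
    show ?thesis
    proof
      fix x assume x: "x \<in> supp X \<mu>"
      have "x n < I" for n
      proof (rule ccontr)
        assume "\<not> x n < I"
        let ?U = "(\<lambda>x :: nat \<Rightarrow> nat. x n) -` {I..}"
        have "open ?U"
          by (intro open_vimage continuous_on_product_coordinates) (rule discrete_topology_class.open_discrete)
        moreover have "x \<in> ?U" using \<open>\<not> x n < I\<close> by simp
        ultimately have "0 < emeasure \<mu> (?U \<inter> X)" using x by (auto simp: supp_def)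
        moreover have "?U \<inter> X = {x \<in> X. I \<le> x n}" by auto
        ultimately show False using far_n[of n] by (simp add: emeasure_eq_measure)
      qed
      then show "x \<in> Y" using x by (simp add: Y_def supp_def)
    qed
  qed
  ultimately show ?thesis using max_\<nu> by blast
qed

end
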